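(* Let $L>2m>0$. For the MKN black hole with parameters $(L,m)$, let $A$ be the area of its horizon and $D$ the distance along the axis between the two poles of the horizon. Then $$\frac{D^{2}}{A}\geq \frac{1}{130}\left(\frac{L}{2m}-1\right).$$
   Context: MKN (Myers/Korotkin-Nicolai, "periodic Schwarzschild") black hole with parameters $(L,m)$, $L/2>m>0$: the static vacuum metric, in Weyl-Papapetrou coordinates $t\in\mathbb{R}$, $\varphi\in\mathbb{R}/2\pi\mathbb{Z}$, $\rho>0$, $z\in\mathbb{R}/L\mathbb{Z}$ (represented by $-L/2\le z\le L/2$ with endpoints identified), $$\mathfrak{g}_{\rm MKN}=-e^{\omega}dt^{2}+e^{-\omega}\big(e^{2k}(dz^{2}+d\rho^{2})+\rho^{2}d\varphi^{2}\big).$$ Here, with $$\omega_{S}(z,\rho)=\ln\left(\frac{\sqrt{(z-m)^{2}+\rho^{2}}+\sqrt{(z+m)^{2}+\rho^{2}}-2m}{\sqrt{(z-m)^{2}+\rho^{2}}+\sqrt{(z+m)^{2}+\rho^{2}}+2m}\right),\quad z\in\mathbb{R},\ \rho>0,$$ one sets $$\omega(z,\rho)=\omega_S(z,\rho)+\sum_{j\in\mathbb{Z}\setminus\{0\}}\Big(\omega_S(z+jL,\rho)+\frac{2m}{|j|L}\Big),$$ which is $L$-periodic in $z$, and $k$ is the ($L$-periodic) solution of $k_{\rho}=\frac{\rho}{4}(\omega_{\rho}^{2}-\omega_{z}^{2})$, $k_{z}=\frac{\rho}{2}\omega_{z}\omega_{\rho}$ normalized so that $k=0$ on the axis $\{\rho=0,\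 m<|z|\le L/2\}$ (no struts). The horizon corresponds to $\{\rho=0,\ |z|\le m\}$; it is a 2-sphere whose poles are the points $z=\pm m$. $A$ is the area of the horizon 2-sphere in the metric induced on $\{t={\rm const}\}$, i.e. $A=2\pi\int_{-m}^{m}\lim_{\rho\to0^+}\big(\rho\, e^{k-\omega}\big)\,dz$. $D$ is the length, in the metric induced on $\{t={\rm const}\}$, of the axis segment joining the two poles outside the horizon, i.e. $D=\int_{m}^{L-m}e^{-\omega(z,0)/2}\,dz$ (the axis being $\{\rho=0,\ m<z<L-m\}$ modulo $L$). *)

theory Defs
  imports "HOL-Analysis.Analysis"
begin

text \<open>
  In Weyl-Papapetrou coordinates \<open>(t, z, \<rho>, \<phi>)\<close> the MKN metric is
  \<open>- e\<^sup>\<omega> dt\<^sup>2 + e\<^sup>-\<^sup>\<omega> (e\<^sup>2\<^sup>k (dz\<^sup>2 + d\<rho>\<^sup>2) + \<rho>\<^sup>2 d\<phi>\<^sup>2)\<close> with \<open>z\<close> taken modulo \<open>L\<close>. Functions on the circle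
  \<open>\<real>/L\<int>\<close> are rendered as \<open>L\<close>-periodic functions on \<open>\<real>\<close>, and arguments are in the
  order \<open>z\<close>, \<open>\<rho>\<close>.
\<close>

definition omega_S :: "real \<Rightarrow> real \<Rightarrow> real \<Rightarrow> real" where
  "omega_S m z \<rho> =
     ln ((sqrt ((z - m)\<^sup>2 + \<rho>\<^sup>2) + sqrt ((z + m)\<^sup>2 + \<rho>\<^sup>2) - 2 * m) /
         (sqrt ((z - m)\<^sup>2 + \<rho>\<^sup>2) + sqrt ((z + m)\<^sup>2 + \<rho>\<^sup>2) + 2 * m))"

text \<open>
  The renormalised terms are \<open>O(1/j\<^sup>2)\<close>, so the series converges absolutely. The same formula
  gives the continuous extension of \<open>\<omega>\<close> to the axis outside the horizon and its translates, since
  the argument of each logarithm stays positive there.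
\<close>

definition mkn_omega :: "real \<Rightarrow> real \<Rightarrow> real \<Rightarrow> real \<Rightarrow> real" where
  "mkn_omega L m z \<rho> =
     omega_S m z \<rho> +
     (\<Sum>\<^sub>\<infinity>j\<in>UNIV - {0::int}. omega_S m (z + of_int j * L) \<rho> + 2 * m / (\<bar>of_int j\<bar> * L))"

definition mkn_omega_z :: "real \<Rightarrow> real \<Rightarrow> real \<Rightarrow> real \<Rightarrow> real" where
  "mkn_omega_z L m z \<rho> = deriv (\<lambda>x. mkn_omega L m x \<rho>) z"

definition mkn_omega_rho :: "real \<Rightarrow> real \<Rightarrow> real \<Rightarrow> real \<Rightarrow> real" where
  "mkn_omega_rho L m z \<rho> = deriv (\<lambda>r. mkn_omega L m z r) \<rho>"

text \<open>
  The conditions determine \<open>k\<close> uniquely on \<open>\<rho> > 0\<close>; its values for \<open>\<rho> \<le> 0\<close> are irrelevant,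
  and the value on the axis is the limit as \<open>\<rho>\<close> decreases to \<open>0\<close>.
\<close>

definition is_mkn_k :: "real \<Rightarrow> real \<Rightarrow> (real \<Rightarrow> real \<Rightarrow> real) \<Rightarrow> bool" where
  "is_mkn_k L m k \<longleftrightarrow>
     (\<forall>z. \<forall>\<rho>>0. k (z + L) \<rho> = k z \<rho>) \<and>
     (\<forall>z. \<forall>\<rho>>0. ((\<lambda>r. k z r) has_real_derivative
        \<rho> / 4 * ((mkn_omega_rho L m z \<rho>)\<^sup>2 - (mkn_omega_z L m z \<rho>)\<^sup>2)) (at \<rho>)) \<and>
     (\<forall>z. \<forall>\<rho>>0. ((\<lambda>x. k x \<rho>) has_real_derivative
        \<rho> / 2 * (mkn_omega_z L m z \<rho> * mkn_omega_rho L m z \<rho>)) (at z)) \<and>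
     (\<forall>z. m < \<bar>z\<bar> \<and> \<bar>z\<bar> \<le> L / 2 \<longrightarrow> ((\<lambda>\<rho>. k z \<rho>) \<longlongrightarrow> 0) (at_right 0))"

text \<open>
  On a surface \<open>t = const\<close>, \<open>\<rho> = const\<close> the area element is
  \<open>sqrt (g\<^sub>z\<^sub>z g\<^sub>\<phi>\<^sub>\<phi>) = \<rho> e\<^sup>k\<^sup>-\<^sup>\<omega>\<close>; the horizon is the limit \<open>\<rho> \<rightarrow> 0\<close> for \<open>\<bar>z\<bar> \<le> m\<close>, and the angle
  contributes the factor \<open>2 \<pi>\<close>.
\<close>

definition mkn_horizon_area :: "real \<Rightarrow> real \<Rightarrow> (real \<Rightarrow> real \<Rightarrow> real) \<Rightarrow> real" where
  "mkn_horizon_area L m k =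
     2 * pi * integral {-m..m}
       (\<lambda>z. Lim (at_right 0) (\<lambda>\<rho>. \<rho> * exp (k z \<rho> - mkn_omega L m z \<rho>)))"

text \<open>
  Since \<open>k = 0\<close> on the axis, the line element there is \<open>sqrt g\<^sub>z\<^sub>z = e\<^sup>-\<^sup>\<omega>\<^sup>/\<^sup>2\<close>. The integrand has
  integrable inverse square root singularities at the two poles.
\<close>

definition mkn_pole_distance :: "real \<Rightarrow> real \<Rightarrow> real" where
  "mkn_pole_distance L m = integral {m..L - m} (\<lambda>z. exp (- mkn_omega L m z 0 / 2))"

end

theory Submission
  imports Defs
begin

text \<open>
  Write \<open>\<omega> = \<omega>\<^sub>S + h\<close>, where \<open>h\<close> collects the periodic images and is regular near the horizon and its poles.
  With \<open>k\<^sub>S\<close> the function \<open>k\<close> of a single Schwarzschild rod, the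
  \<open>z\<close>-derivative of \<open>k - k\<^sub>S\<close> tends to \<open>0\<close> on the axis and to \<open>h\<^sub>z\<close> on the horizon as \<open>\<rho> \<rightarrow> 0\<close>, with errors
  controlled by the explicit primitive \<open>r\<^sub>2 - r\<^sub>1\<close> (the difference of the distances to the two poles) across
  the pole. Hence \<open>\<rho> e\<^sup>k\<^sup>-\<^sup>\<omega>\<close> tends to the constant \<open>4 m exp (- h(m, 0))\<close> on the horizon and
  \<open>A = 16 \<pi> m\<^sup>2 exp (- h(m, 0))\<close>.

  On the axis, \<open>h(z, 0) \<le> h(m, 0)\<close> since each pair of images contributes a function decreasing in \<open>\<bar>z\<bar>\<close>. So the
  factor \<open>exp (- h(m, 0))\<close> cancels in \<open>D\<^sup>2 / A\<close>, and integrating \<open>sqrt (2 m / (z - m))\<close> gives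
  \<open>D\<^sup>2 / A \<ge> (L / (2 m) - 1) / \<pi>\<close>.
\<close>

subsection \<open>The rod potential and its periodic images\<close>

text \<open>Up to sign this is the Newtonian potential of a uniform rod filling the half-axis
  \<open>s \<le> 0\<close>; its \<open>s\<close>-derivative is the reciprocal distance to the end of
  the rod. The recurring hypothesis \<open>\<rho> \<noteq> 0 \<or> s > 0\<close> places the point
  off that half-axis.\<close>

definition rod :: "real \<Rightarrow> real \<Rightarrow> real" where
  "rod s \<rho> = ln (s + sqrt (s\<^sup>2 + \<rho>\<^sup>2))"

lemma rod_arg_pos:
  assumes "\<rho> \<noteq> 0 \<or> s > 0"
  shows "0 < s + sqrt (s\<^sup>2 + \<rho>\<^sup>2)"
proof (cases "\<rho> = 0")
  case True
  with assms show ?thesis by simp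
next
  case False
  then have "\<bar>s\<bar> < sqrt (s\<^sup>2 + \<rho>\<^sup>2)"
    by (intro real_less_rsqrt) simp
  then show ?thesis by linarith
qed

lemma rod_root_pos:
  assumes "\<rho> \<noteq> 0 \<or> s > 0"
  shows "0 < sqrt (s\<^sup>2 + (\<rho>::real)\<^sup>2)"
  using assms by (auto simp: sum_power2_gt_zero_iff)

lemma has_derivative_rod_left:
  assumes "\<rho> \<noteq> 0 \<or> s > 0"
  shows "((\<lambda>s. rod s \<rho>) has_real_derivative 1 / sqrt (s\<^sup>2 + \<rho>\<^sup>2)) (at s)"
proof -
  have 1: "0 < s + sqrt (s\<^sup>2 + \<rho>\<^sup>2)" and 2: "0 < sqrt (s\<^sup>2 + \<rho>\<^sup>2)"
    using rod_arg_pos[OF assms] rod_root_pos[OF assms] by auto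
  have "((\<lambda>s. rod s \<rho>) has_real_derivative
      (1 + s / sqrt (s\<^sup>2 + \<rho>\<^sup>2)) / (s + sqrt (s\<^sup>2 + \<rho>\<^sup>2))) (at s)"
    unfolding rod_def using 1 2
    by (auto intro!: derivative_eq_intros simp: divide_simps)
  also have "(1 + s / sqrt (s\<^sup>2 + \<rho>\<^sup>2)) / (s + sqrt (s\<^sup>2 + \<rho>\<^sup>2)) = 1 / sqrt (s\<^sup>2 + \<rho>\<^sup>2)"
    using 1 2 by (simp add: divide_simps)
  finally show ?thesis .
qed

lemma has_derivative_rod_right:
  assumes "\<rho> \<noteq> 0 \<or> s > 0"
  shows "(rod s has_real_derivative
    \<rho> / (sqrt (s\<^sup>2 + \<rho>\<^sup>2) * (s + sqrt (s\<^sup>2 + \<rho>\<^sup>2)))) (at \<rho>)"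
proof -
  have 1: "0 < s + sqrt (s\<^sup>2 + \<rho>\<^sup>2)" and 2: "0 < sqrt (s\<^sup>2 + \<rho>\<^sup>2)"
    using rod_arg_pos[OF assms] rod_root_pos[OF assms] by auto
  have "((\<lambda>\<rho>. rod s \<rho>) has_real_derivative
      \<rho> / (sqrt (s\<^sup>2 + \<rho>\<^sup>2) * (s + sqrt (s\<^sup>2 + \<rho>\<^sup>2)))) (at \<rho>)"
    unfolding rod_def using 1 2
    by (auto intro!: derivative_eq_intros simp: divide_simps)
  then show ?thesis by simp
qed

text \<open>Follows from (r - s)(r + s) = \<rho>^2. The left form remains meaningful at
  \<open>\<rho> = 0\<close> for \<open>s > 0\<close>, as the images require; the right form isolates
  the factor 1/\<rho> needed in the equation for \<open>k\<close>.\<close>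

lemma rod_derivative_right_eq:
  assumes "\<rho> > 0"
  shows "\<rho> / (sqrt (s\<^sup>2 + \<rho>\<^sup>2) * (s + sqrt (s\<^sup>2 + \<rho>\<^sup>2))) = (1 - s / sqrt (s\<^sup>2 + \<rho>\<^sup>2)) / \<rho>"
proof -
  define r where "r = sqrt (s\<^sup>2 + \<rho>\<^sup>2)"
  have 1: "0 < s + r" and 2: "0 < r" and 3: "r\<^sup>2 = s\<^sup>2 + \<rho>\<^sup>2"
    using rod_arg_pos[of \<rho> s] rod_root_pos[of \<rho> s] assms by (auto simp: r_def)
  have "\<rho> * (r * \<rho>) = (r - s) * (r * (s + r))"
    using 3 by (simp add: power2_eq_square) algebra
  with 1 2 assms have "\<rho> / (r * (s + r)) = (r - s) / (r * \<rho>)"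
    by (subst frac_eq_eq) auto
  also have "\<dots> = (1 - s / r) / \<rho>"
    using 2 by (simp add: diff_divide_distrib)
  finally show ?thesis
    unfolding r_def .
qed

text \<open>A finite rod is the difference of two half-infinite ones. This replaces the quotient in
  \<open>omega_S\<close> by functions with simple derivatives.\<close>

lemma omega_S_eq_rod:
  assumes "0 < m" "\<rho> \<noteq> 0 \<or> m < t"
  shows "omega_S m t \<rho> = rod (t - m) \<rho> - rod (t + m) \<rho>"
proof -
  define r1 where "r1 = sqrt ((t - m)\<^sup>2 + \<rho>\<^sup>2)"
  define r2 where "r2 = sqrt ((t + m)\<^sup>2 + \<rho>\<^sup>2)"
  have p: "0 < t - m + r1" "0 < t + m + r2"
    unfolding r1_def r2_def using assms by (auto intro!: rod_arg_pos)
  have "0 \<le> r1" "0 \<le> r2" by (auto simp: r1_def r2_def)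
  have sq: "r1\<^sup>2 = (t - m)\<^sup>2 + \<rho>\<^sup>2" "r2\<^sup>2 = (t + m)\<^sup>2 + \<rho>\<^sup>2"
    by (simp_all add: r1_def r2_def)
  have R: "0 < r1 + r2 + 2 * m" using \<open>0 \<le> r1\<close> \<open>0 \<le> r2\<close> assms by linarith
  \<comment> \<open>After expansion this is r2^2 - r1^2 = 4 m t.\<close>
  have "(r1 + r2 - 2 * m) * (t + m + r2) = (r1 + r2 + 2 * m) * (t - m + r1)"
    using sq by (simp add: power2_eq_square algebra_simps)
  then have "(r1 + r2 - 2 * m) / (r1 + r2 + 2 * m) = (t - m + r1) / (t + m + r2)"
    using p R by (simp add: divide_simps mult_ac)
  then show ?thesis
    unfolding omega_S_def rod_def r1_def[symmetric] r2_def[symmetric]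
    using p by (simp add: ln_div)
qed

lemma omega_S_minus: "omega_S m (- t) \<rho> = omega_S m t \<rho>"
proof -
  have "(- t - m)\<^sup>2 = (t + m)\<^sup>2" "(- t + m)\<^sup>2 = (t - m)\<^sup>2"
    by (simp_all add: power2_eq_square algebra_simps)
  then show ?thesis unfolding omega_S_def by (simp only: add_ac)
qed

lemma omega_S_axis:
  assumes "0 < m" "m < t"
  shows "omega_S m t 0 = ln ((t - m) / (t + m))"
proof -
  have "(t - m + (t + m) - 2 * m) / (t - m + (t + m) + 2 * m) = (t - m) / (t + m)"
    using assms by (simp add: divide_simps) (simp add: algebra_simps)
  then show ?thesis unfolding omega_S_def using assms by simp
qed

lemma has_derivative_omega_S_left:
  assumes "0 < m" "\<rho> \<noteq> 0 \<or> m < t"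
  shows "((\<lambda>t. omega_S m t \<rho>) has_real_derivative
    1 / sqrt ((t - m)\<^sup>2 + \<rho>\<^sup>2) - 1 / sqrt ((t + m)\<^sup>2 + \<rho>\<^sup>2)) (at t)"
proof -
  define S where "S = (if \<rho> \<noteq> 0 then UNIV else {m<..})"
  have S: "open S" "t \<in> S" "\<And>x. x \<in> S \<Longrightarrow> \<rho> \<noteq> 0 \<or> m < x"
    using assms by (auto simp: S_def split: if_splits)
  have "((\<lambda>t. rod (t - m) \<rho> - rod (t + m) \<rho>) has_real_derivative
    1 / sqrt ((t - m)\<^sup>2 + \<rho>\<^sup>2) * 1 - 1 / sqrt ((t + m)\<^sup>2 + \<rho>\<^sup>2) * 1) (at t)"
    using assms
    by (intro DERIV_diff DERIV_chain2[OF has_derivative_rod_left]) (auto intro!: derivative_eq_intros)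
  then have "((\<lambda>t. omega_S m t \<rho>) has_real_derivative
    1 / sqrt ((t - m)\<^sup>2 + \<rho>\<^sup>2) * 1 - 1 / sqrt ((t + m)\<^sup>2 + \<rho>\<^sup>2) * 1) (at t)"
    by (rule has_field_derivative_transform_within_open[OF _ S(1,2)])
       (use S(3) assms in \<open>auto simp: omega_S_eq_rod\<close>)
  then show ?thesis by simp
qed

text \<open>Covers \<open>\<rho> = 0\<close> above the rod, where the images must be differentiated
  in order to be continuous up to the axis.\<close>

lemma has_derivative_omega_S_right_rod:
  assumes "0 < m" "\<rho> \<noteq> 0 \<or> m < t"
  shows "(omega_S m t has_real_derivative
    \<rho> / (sqrt ((t - m)\<^sup>2 + \<rho>\<^sup>2) * (t - m + sqrt ((t - m)\<^sup>2 + \<rho>\<^sup>2))) -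
    \<rho> / (sqrt ((t + m)\<^sup>2 + \<rho>\<^sup>2) * (t + m + sqrt ((t + m)\<^sup>2 + \<rho>\<^sup>2)))) (at \<rho>)"
proof -
  define S where "S = (if m < t then UNIV else - {0::real})"
  have S: "open S" "\<rho> \<in> S" "\<And>x. x \<in> S \<Longrightarrow> x \<noteq> 0 \<or> m < t"
    using assms by (auto simp: S_def split: if_splits)
  have "((\<lambda>\<rho>. rod (t - m) \<rho> - rod (t + m) \<rho>) has_real_derivative
    \<rho> / (sqrt ((t - m)\<^sup>2 + \<rho>\<^sup>2) * (t - m + sqrt ((t - m)\<^sup>2 + \<rho>\<^sup>2))) -
    \<rho> / (sqrt ((t + m)\<^sup>2 + \<rho>\<^sup>2) * (t + m + sqrt ((t + m)\<^sup>2 + \<rho>\<^sup>2)))) (at \<rho>)"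
    using assms by (intro DERIV_diff has_derivative_rod_right) auto
  then show ?thesis
    by (rule has_field_derivative_transform_within_open[OF _ S(1,2)])
       (use S(3) assms in \<open>auto simp: omega_S_eq_rod\<close>)
qed

lemma has_derivative_omega_S_right:
  assumes "0 < m" "0 < \<rho>"
  shows "(omega_S m t has_real_derivative
    ((t + m) / sqrt ((t + m)\<^sup>2 + \<rho>\<^sup>2) - (t - m) / sqrt ((t - m)\<^sup>2 + \<rho>\<^sup>2)) / \<rho>) (at \<rho>)"
proof -
  have "(1 - (t - m) / sqrt ((t - m)\<^sup>2 + \<rho>\<^sup>2)) / \<rho> - (1 - (t + m) / sqrt ((t + m)\<^sup>2 + \<rho>\<^sup>2)) / \<rho> =
      ((t + m) / sqrt ((t + m)\<^sup>2 + \<rho>\<^sup>2) - (t - m) / sqrt ((t - m)\<^sup>2 + \<rho>\<^sup>2)) / \<rho>"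
    unfolding diff_divide_distrib[symmetric] by simp
  with has_derivative_omega_S_right_rod[of m \<rho> t] assms show ?thesis
    by (simp only: rod_derivative_right_eq) simp
qed

section \<open>Estimates, convergence and derivatives of the image sums\<close>

lemma root_diff_le:
  assumes "0 < m"
  shows "\<bar>sqrt ((t + m)\<^sup>2 + \<rho>\<^sup>2) - sqrt ((t - m)\<^sup>2 + \<rho>\<^sup>2)\<bar> \<le> 2 * m"
proof -
  have "\<bar>norm (t + m, \<rho>) - norm (t - m, \<rho>)\<bar> \<le> norm ((t + m, \<rho>) - (t - m, \<rho>))"
    by (rule norm_triangle_ineq3)
  then show ?thesis using assms by (simp add: norm_Pair real_sqrt_mult)
qed

lemma root_ge_abs: "\<bar>s\<bar> \<le> sqrt (s\<^sup>2 + (\<rho>::real)\<^sup>2)"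
  by (intro real_le_rsqrt) simp

text \<open>
  \<open>image_sum\<close> is the sum over the images on one side only: since \<open>omega_S\<close> is even in \<open>z\<close>, the other
  side is \<open>image_sum\<close> at \<open>- z\<close>.
\<close>

definition image_term :: "real \<Rightarrow> real \<Rightarrow> real \<Rightarrow> real \<Rightarrow> nat \<Rightarrow> real" where
  "image_term L m s \<rho> n = omega_S m ((real n + 1) * L + s) \<rho> + 2 * m / ((real n + 1) * L)"

definition image_sum :: "real \<Rightarrow> real \<Rightarrow> real \<Rightarrow> real \<Rightarrow> real" where
  "image_sum L m s \<rho> = (\<Sum>n. image_term L m s \<rho> n)"

text \<open>The nearest image rod on this side ends at m - L, so \<open>a\<close> is a margin
  between \<open>s\<close> and that end. The distance to the further images then grows at least
  linearly in \<open>n\<close>.\<close>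

lemma image_gap:
  fixes L m a s :: real
  assumes "a \<le> L" "m - L + a \<le> s"
  shows "(real n + 1) * a \<le> (real n + 1) * L + s - m"
proof -
  have "real n * a \<le> real n * L" using assms by (intro mult_left_mono) auto
  with assms show ?thesis by (simp add: algebra_simps)
qed

text \<open>By the mean value theorem \<open>omega_S\<close> equals -2m/r for an intermediate
  distance r. Since r differs from (n+1)L by a bounded amount, the renormalising constant cancels
  the leading order and leaves a multiple of 1/(n+1)^2.\<close>

lemma image_term_bound:
  assumes "0 < m" "0 < a" "a \<le> L" "m - L + a \<le> s"
  shows "\<bar>image_term L m s \<rho> n\<bar> \<le> 2 * m * (\<bar>s\<bar> + m + \<bar>\<rho>\<bar>) / (L * a) * (1 / (real n + 1)\<^sup>2)"
proof -
  define N where "N = real n + 1"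
  have N: "0 < N" by (simp add: N_def)
  define t where "t = N * L + s"
  have L: "0 < L" using assms by simp
  have gap: "N * a \<le> t - m" using image_gap[OF assms(3,4), of n] by (simp add: N_def t_def)
  have Na: "0 < N * a" using N assms by simp
  have "\<exists>\<xi>>t - m. \<xi> < t + m \<and>
      rod (t + m) \<rho> - rod (t - m) \<rho> = (t + m - (t - m)) * (1 / sqrt (\<xi>\<^sup>2 + \<rho>\<^sup>2))"
    using assms gap Na by (intro MVT2 has_derivative_rod_left) auto
  then obtain \<xi> where \<xi>: "t - m < \<xi>" "\<xi> < t + m"
    and eq: "rod (t + m) \<rho> - rod (t - m) \<rho> = 2 * m / sqrt (\<xi>\<^sup>2 + \<rho>\<^sup>2)"
    by (auto simp: algebra_simps)
  define r where "r = sqrt (\<xi>\<^sup>2 + \<rho>\<^sup>2)"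
  have r: "N * a \<le> r" using root_ge_abs[of \<xi> \<rho>] \<xi> gap unfolding r_def by linarith
  have rle: "r \<le> \<bar>\<xi>\<bar> + \<bar>\<rho>\<bar>"
    unfolding r_def using sqrt_sum_squares_le_sum_abs[of \<xi> \<rho>] by simp
  have dist: "\<bar>r - N * L\<bar> \<le> \<bar>s\<bar> + m + \<bar>\<rho>\<bar>"
    using rle root_ge_abs[of \<xi> \<rho>, folded r_def] \<xi> gap Na assms by (auto simp: t_def)
  have "image_term L m s \<rho> n = 2 * m / (N * L) - 2 * m / r"
    unfolding image_term_def N_def[symmetric] t_def[symmetric]
    using omega_S_eq_rod[of m \<rho> t] assms gap Na eq r_def by auto
  also have "\<dots> = 2 * m * (r - N * L) / (N * L * r)"
    using r Na N L by (simp add: divide_simps) (simp add: algebra_simps)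
  finally have "\<bar>image_term L m s \<rho> n\<bar> = 2 * m * \<bar>r - N * L\<bar> / (N * L * r)"
    using less_le_trans[OF Na r] N L assms by (simp add: abs_mult)
  also have "\<dots> \<le> 2 * m * (\<bar>s\<bar> + m + \<bar>\<rho>\<bar>) / (N * L * (N * a))"
    using r Na N L assms dist by (intro frac_le mult_left_mono mult_nonneg_nonneg) auto
  also have "\<dots> = 2 * m * (\<bar>s\<bar> + m + \<bar>\<rho>\<bar>) / (L * a) * (1 / (real n + 1)\<^sup>2)"
    by (simp add: N_def power2_eq_square mult_ac)
  finally show ?thesis .
qed

lemma summable_inverse_Suc_squares: "summable (\<lambda>n. 1 / (real n + 1)\<^sup>2)"
proof -
  have "summable (\<lambda>n. inverse (real (Suc n) ^ 2))"
    by (subst summable_Suc_iff) (simp add: inverse_power_summable)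
  then show ?thesis by (simp add: inverse_eq_divide add.commute)
qed

lemma summable_image_term:
  assumes "0 < m" "m < L" "m - L < s"
  shows "summable (\<lambda>n. \<bar>image_term L m s \<rho> n\<bar>)"
proof (rule summable_comparison_test')
  define a where "a = min L (s + L - m)"
  have a: "0 < a" "a \<le> L" "m - L + a \<le> s" using assms by (auto simp: a_def)
  show "summable (\<lambda>n. 2 * m * (\<bar>s\<bar> + m + \<bar>\<rho>\<bar>) / (L * a) * (1 / (real n + 1)\<^sup>2))"
    by (intro summable_mult summable_inverse_Suc_squares)
  show "norm \<bar>image_term L m s \<rho> n\<bar> \<le>
      2 * m * (\<bar>s\<bar> + m + \<bar>\<rho>\<bar>) / (L * a) * (1 / (real n + 1)\<^sup>2)" if "n \<ge> 0" for n
    using image_term_bound[OF assms(1) a] by simp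
qed

text \<open>Absolute convergence allows the unordered sum over nonzero integers to be split into
  positive and negative indices, and evenness of \<open>omega_S\<close> turns the negative half into
  \<open>image_sum\<close> at \<open>- z\<close>. The bound on \<open>z\<close> keeps both
  \<open>z\<close> and \<open>- z\<close> beyond m - L, clear of the image rods.\<close>

lemma mkn_omega_eq:
  assumes "0 < m" "m < L" "\<bar>z\<bar> < L - m"
  shows "mkn_omega L m z \<rho> = omega_S m z \<rho> + image_sum L m z \<rho> + image_sum L m (- z) \<rho>"
proof -
  define f where "f = (\<lambda>j::int. omega_S m (z + of_int j * L) \<rho> + 2 * m / (\<bar>of_int j\<bar> * L))"
  define p where "p = (\<lambda>n. int n + 1)"
  define q where "q = (\<lambda>n. - (int n + 1))"
  have hs: "(image_term L m s \<rho> has_sum image_sum L m s \<rho>) UNIV" if "m - L < s" for s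
    unfolding image_sum_def
    using summable_image_term[OF assms(1,2) that, of \<rho>]
    by (intro norm_summable_imp_has_sum summable_sums) (auto intro: summable_rabs_cancel)
  have fp: "f \<circ> p = image_term L m z \<rho>"
    by (auto simp: fun_eq_iff f_def p_def image_term_def add_ac)
  have fq: "f \<circ> q = image_term L m (- z) \<rho>"
  proof
    fix n
    have "omega_S m (z - (real n + 1) * L) \<rho> = omega_S m ((real n + 1) * L - z) \<rho>"
      using omega_S_minus[of m "z - (real n + 1) * L" \<rho>] by simp
    then show "(f \<circ> q) n = image_term L m (- z) \<rho> n"
      by (simp add: f_def q_def image_term_def algebra_simps)
  qed
  have "inj p" "inj q" by (auto simp: inj_def p_def q_def)
  have "(f has_sum image_sum L m z \<rho>) (range p)"
    using hs[of z] assms by (subst has_sum_reindex[OF \<open>inj p\<close>]) (simp add: fp)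
  moreover have "(f has_sum image_sum L m (- z) \<rho>) (range q)"
    using hs[of "- z"] assms by (subst has_sum_reindex[OF \<open>inj q\<close>]) (simp add: fq)
  moreover have "range p \<inter> range q = {}" by (auto simp: p_def q_def)
  ultimately have "(f has_sum (image_sum L m z \<rho> + image_sum L m (- z) \<rho>)) (range p \<union> range q)"
    by (rule has_sum_Un_disjoint)
  moreover have "range p \<union> range q = UNIV - {0}"
  proof (intro equalityI subsetI)
    fix j :: int assume "j \<in> UNIV - {0}"
    then have "j = p (nat (j - 1)) \<or> j = q (nat (- j - 1))" by (auto simp: p_def q_def)
    then show "j \<in> range p \<union> range q" by blast
  qed (auto simp: p_def q_def)
  ultimately have "infsum f (UNIV - {0}) = image_sum L m z \<rho> + image_sum L m (- z) \<rho>"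
    by (simp add: infsumI)
  then show ?thesis unfolding mkn_omega_def f_def by simp
qed

text \<open>Termwise differentiation, justified by the Weierstrass M-test with majorants of order
  1/(n+1)^2. The constant is uniform in both variables, and the explicit factor \<rho> of each term
  survives in the bound on the \<rho>-derivative.\<close>

lemma image_sum_derivatives:
  assumes "0 < m" "0 < a" "a < L - m"
  obtains C where "0 \<le> C"
    and "\<And>s \<rho>. m - L + a < s \<Longrightarrow>
      \<exists>d. ((\<lambda>s. image_sum L m s \<rho>) has_real_derivative d) (at s) \<and> \<bar>d\<bar> \<le> C"
    and "\<And>s \<rho>. m - L + a < s \<Longrightarrow>
      \<exists>e. (image_sum L m s has_real_derivative e) (at \<rho>) \<and> \<bar>e\<bar> \<le> C * \<bar>\<rho>\<bar>"
proof -
  let ?t = "\<lambda>n s. (real n + 1) * L + s"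
  let ?dz = "\<lambda>\<rho> n s. 1 / sqrt ((?t n s - m)\<^sup>2 + \<rho>\<^sup>2) - 1 / sqrt ((?t n s + m)\<^sup>2 + \<rho>\<^sup>2)"
  let ?dr = "\<lambda>s n \<rho>. \<rho> / (sqrt ((?t n s - m)\<^sup>2 + \<rho>\<^sup>2) * (?t n s - m + sqrt ((?t n s - m)\<^sup>2 + \<rho>\<^sup>2))) -
    \<rho> / (sqrt ((?t n s + m)\<^sup>2 + \<rho>\<^sup>2) * (?t n s + m + sqrt ((?t n s + m)\<^sup>2 + \<rho>\<^sup>2)))"
  define Z where "Z = (\<Sum>n. 1 / (real n + 1)\<^sup>2)"
  have Z: "0 \<le> Z" unfolding Z_def by (intro suminf_nonneg summable_inverse_Suc_squares) simp
  have aL: "a \<le> L" using assms by simp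
  have gap: "0 < (real n + 1) * a" "(real n + 1) * a \<le> ?t n s - m" if "m - L + a < s" for n s
    using image_gap[of a L m s n] that assms by auto
  have dz_bound: "\<bar>?dz \<rho> n s\<bar> \<le> 2 * m / a\<^sup>2 * (1 / (real n + 1)\<^sup>2)" if "m - L + a < s" for \<rho> n s
  proof -
    define r1 where "r1 = sqrt ((?t n s - m)\<^sup>2 + \<rho>\<^sup>2)"
    define r2 where "r2 = sqrt ((?t n s + m)\<^sup>2 + \<rho>\<^sup>2)"
    have r: "(real n + 1) * a \<le> r1" "(real n + 1) * a \<le> r2"
      using gap[OF that, of n] root_ge_abs[of "?t n s - m" \<rho>] root_ge_abs[of "?t n s + m" \<rho>] assms
      unfolding r1_def r2_def by linarith+
    then have p: "0 < r1" "0 < r2" using gap[OF that, of n] by auto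
    have "\<bar>?dz \<rho> n s\<bar> = \<bar>r2 - r1\<bar> / (r1 * r2)"
      unfolding r1_def[symmetric] r2_def[symmetric] using p
      by (simp add: diff_frac_eq abs_mult)
    also have "\<dots> \<le> 2 * m / ((real n + 1) * a * ((real n + 1) * a))"
      using r p root_diff_le[OF assms(1), of "?t n s" \<rho>] gap[OF that, of n] assms
      unfolding r1_def[symmetric] r2_def[symmetric]
      by (intro frac_le mult_mono) (auto simp: less_imp_le[OF p(1)])
    finally show ?thesis by (simp add: power2_eq_square mult_ac)
  qed
  have dr_bound: "\<bar>?dr s n \<rho>\<bar> \<le> \<bar>\<rho>\<bar> / a\<^sup>2 * (1 / (real n + 1)\<^sup>2)" if "m - L + a < s" for \<rho> n s
  proof -
    define A where "A = (real n + 1) * a"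
    have A: "0 < A" "A \<le> ?t n s - m" using gap[OF that, of n] by (auto simp: A_def)
    define P1 where "P1 = sqrt ((?t n s - m)\<^sup>2 + \<rho>\<^sup>2) * (?t n s - m + sqrt ((?t n s - m)\<^sup>2 + \<rho>\<^sup>2))"
    define P2 where "P2 = sqrt ((?t n s + m)\<^sup>2 + \<rho>\<^sup>2) * (?t n s + m + sqrt ((?t n s + m)\<^sup>2 + \<rho>\<^sup>2))"
    \<comment> \<open>The two factors are at least A and 2A; the resulting 2 absorbs the sum of the
      two fractions below.\<close>
    have P: "2 * A\<^sup>2 \<le> sqrt (x\<^sup>2 + \<rho>\<^sup>2) * (x + sqrt (x\<^sup>2 + \<rho>\<^sup>2))" if "A \<le> x" for x
    proof -
      have "A * (A + A) \<le> sqrt (x\<^sup>2 + \<rho>\<^sup>2) * (x + sqrt (x\<^sup>2 + \<rho>\<^sup>2))"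
        using order_trans[OF that order_trans[OF abs_ge_self root_ge_abs[of x \<rho>]]] that A(1)
        by (intro mult_mono add_mono) auto
      then show ?thesis by (simp add: power2_eq_square)
    qed
    have P12: "2 * A\<^sup>2 \<le> P1" "2 * A\<^sup>2 \<le> P2" unfolding P1_def P2_def using A assms by (auto intro!: P)
    have "0 < 2 * A\<^sup>2" using A(1) by simp
    then have P_pos: "0 < P1" "0 < P2" using P12 by linarith+
    have "\<bar>?dr s n \<rho>\<bar> \<le> \<bar>\<rho> / P1\<bar> + \<bar>\<rho> / P2\<bar>"
      unfolding P1_def P2_def by (rule abs_triangle_ineq4)
    also have "\<dots> = \<bar>\<rho>\<bar> / P1 + \<bar>\<rho>\<bar> / P2"
      using P_pos by (simp add: abs_divide)
    also have "\<dots> \<le> \<bar>\<rho>\<bar> / (2 * A\<^sup>2) + \<bar>\<rho>\<bar> / (2 * A\<^sup>2)"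
      using P12 P_pos A(1) by (intro add_mono divide_left_mono) auto
    also have "\<dots> = \<bar>\<rho>\<bar> / a\<^sup>2 * (1 / (real n + 1)\<^sup>2)"
      by (simp add: A_def power_mult_distrib)
    finally show ?thesis .
  qed
  \<comment> \<open>The summand 2m serves the \<open>z\<close>-derivative and the summand 1 the
    \<rho>-derivative, so one constant covers both.\<close>
  define C where "C = (2 * m + 1) / a\<^sup>2 * Z"
  have suminf_le: "\<bar>\<Sum>n. g n\<bar> \<le> c * Z"
    if "\<And>n. \<bar>g n\<bar> \<le> c * (1 / (real n + 1)\<^sup>2)" for g c
  proof -
    have s: "summable (\<lambda>n. c * (1 / (real n + 1)\<^sup>2))"
      by (intro summable_mult summable_inverse_Suc_squares)
    have sg: "summable (\<lambda>n. \<bar>g n\<bar>)"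
      by (rule summable_comparison_test'[OF s, of 0]) (use that in simp)
    have "\<bar>\<Sum>n. g n\<bar> \<le> (\<Sum>n. \<bar>g n\<bar>)" by (rule summable_rabs[OF sg])
    also have "\<dots> \<le> (\<Sum>n. c * (1 / (real n + 1)\<^sup>2))" by (rule suminf_le[OF that sg s])
    also have "\<dots> = c * Z" unfolding Z_def by (rule suminf_mult[OF summable_inverse_Suc_squares])
    finally show ?thesis .
  qed
  have sm: "summable (image_term L m s \<rho>)" if "m - L + a < s" for s \<rho>
    using summable_image_term[of m L s \<rho>] that assms by (auto intro: summable_rabs_cancel)
  show ?thesis
  proof (rule that[of C])
    show "0 \<le> C" using Z assms by (simp add: C_def)
    fix s \<rho> :: real assume s: "m - L + a < s"
    have tm: "m < ?t n x" if "m - L + a < x" for n x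
      using gap[OF that, of n] by linarith
    have "((\<lambda>s. \<Sum>n. image_term L m s \<rho> n) has_real_derivative (\<Sum>n. ?dz \<rho> n s)) (at s)"
    proof (rule has_field_derivative_series'(2)[of "{m - L + a<..}" _ _ s])
      fix n x assume x: "x \<in> {m - L + a<..}"
      have "((\<lambda>x. omega_S m (?t n x) \<rho> + 2 * m / ((real n + 1) * L)) has_real_derivative ?dz \<rho> n x * 1 + 0) (at x)"
        using tm[of x n] x assms
        by (intro DERIV_add DERIV_chain2[OF has_derivative_omega_S_left])
           (auto intro!: derivative_eq_intros)
      then show "((\<lambda>x. image_term L m x \<rho> n) has_real_derivative ?dz \<rho> n x) (at x within {m - L + a<..})"
        unfolding image_term_def by (simp add: has_field_derivative_at_within)
    next
      show "uniformly_convergent_on {m - L + a<..} (\<lambda>n x. \<Sum>i<n. ?dz \<rho> i x)"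
        by (intro Weierstrass_m_test'[where M = "\<lambda>n. 2 * m / a\<^sup>2 * (1 / (real n + 1)\<^sup>2)"]
              summable_mult summable_inverse_Suc_squares)
           (use dz_bound in simp)
    qed (use s sm in \<open>auto simp: interior_open\<close>)
    moreover have "\<bar>\<Sum>n. ?dz \<rho> n s\<bar> \<le> 2 * m / a\<^sup>2 * Z" by (rule suminf_le[OF dz_bound[OF s]])
    moreover have "2 * m / a\<^sup>2 * Z \<le> C" unfolding C_def using Z assms
      by (intro mult_right_mono divide_right_mono) auto
    ultimately show "\<exists>d. ((\<lambda>s. image_sum L m s \<rho>) has_real_derivative d) (at s) \<and> \<bar>d\<bar> \<le> C"
      unfolding image_sum_def by (meson order_trans)
    \<comment> \<open>The majorant for the \<rho>-derivative grows with \<rho>, so the M-test is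
      applied on a bounded interval around the given point.\<close>
    define B where "B = \<bar>\<rho>\<bar> + 1"
    have "((\<lambda>\<rho>. \<Sum>n. image_term L m s \<rho> n) has_real_derivative (\<Sum>n. ?dr s n \<rho>)) (at \<rho>)"
    proof (rule has_field_derivative_series'(2)[of "{-B<..<B}" _ _ \<rho>])
      fix n x assume x: "x \<in> {-B<..<B}"
      have "((\<lambda>x. omega_S m (?t n s) x + 2 * m / ((real n + 1) * L)) has_real_derivative ?dr s n x + 0) (at x)"
        using tm[OF s, of n] assms
        by (intro DERIV_add has_derivative_omega_S_right_rod) (auto intro!: derivative_eq_intros)
      then show "((\<lambda>x. image_term L m s x n) has_real_derivative ?dr s n x) (at x within {-B<..<B})"
        unfolding image_term_def by (simp add: has_field_derivative_at_within)
    next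
      show "uniformly_convergent_on {-B<..<B} (\<lambda>n x. \<Sum>i<n. ?dr s i x)"
      proof (rule Weierstrass_m_test'[where M = "\<lambda>n. B / a\<^sup>2 * (1 / (real n + 1)\<^sup>2)"])
        fix n x assume x: "x \<in> {-B<..<B}"
        have "\<bar>?dr s n x\<bar> \<le> \<bar>x\<bar> / a\<^sup>2 * (1 / (real n + 1)\<^sup>2)" by (rule dr_bound[OF s])
        also have "\<dots> \<le> B / a\<^sup>2 * (1 / (real n + 1)\<^sup>2)"
          using x by (intro mult_right_mono divide_right_mono) auto
        finally show "norm (?dr s n x) \<le> B / a\<^sup>2 * (1 / (real n + 1)\<^sup>2)" by simp
      qed (intro summable_mult summable_inverse_Suc_squares)
    qed (use s sm in \<open>auto simp: interior_open B_def\<close>)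
    moreover have "\<bar>\<Sum>n. ?dr s n \<rho>\<bar> \<le> \<bar>\<rho>\<bar> / a\<^sup>2 * Z" by (rule suminf_le[OF dr_bound[OF s]])
    moreover have "\<bar>\<rho>\<bar> / a\<^sup>2 * Z \<le> C * \<bar>\<rho>\<bar>"
    proof -
      have "1 / a\<^sup>2 * Z \<le> C" unfolding C_def using Z assms
        by (intro mult_right_mono divide_right_mono) auto
      then have "1 / a\<^sup>2 * Z * \<bar>\<rho>\<bar> \<le> C * \<bar>\<rho>\<bar>" by (rule mult_right_mono) simp
      then show ?thesis by (simp add: mult_ac)
    qed
    moreover have "image_sum L m s = (\<lambda>\<rho>. \<Sum>n. image_term L m s \<rho> n)"
      by (simp add: fun_eq_iff image_sum_def)
    ultimately show "\<exists>e. (image_sum L m s has_real_derivative e) (at \<rho>) \<and> \<bar>e\<bar> \<le> C * \<bar>\<rho>\<bar>"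
      by (intro exI[of _ "\<Sum>n. ?dr s n \<rho>"]) simp
  qed
qed

subsection \<open>The Schwarzschild solution\<close>

text \<open>With r1, r2 the distances to the poles, P = r1 r2 and e^(2k) = ((r1 + r2)^2 - 4 m^2) /
  (4 r1 r2), the classical \<open>k\<close> of a single rod.\<close>

definition schwarzschild_k :: "real \<Rightarrow> real \<Rightarrow> real \<Rightarrow> real" where
  "schwarzschild_k m z \<rho> =
     (let P = sqrt (((z - m)\<^sup>2 + \<rho>\<^sup>2) * ((z + m)\<^sup>2 + \<rho>\<^sup>2)); S = z\<^sup>2 + \<rho>\<^sup>2 - m\<^sup>2
      in ln ((P + S) / (2 * P)) / 2)"

lemma schwarzschild_root_bounds:
  fixes m z \<rho> :: real
  assumes "0 < m" "0 < \<rho>"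
  defines "P \<equiv> sqrt (((z - m)\<^sup>2 + \<rho>\<^sup>2) * ((z + m)\<^sup>2 + \<rho>\<^sup>2))" and "S \<equiv> z\<^sup>2 + \<rho>\<^sup>2 - m\<^sup>2"
  shows "P\<^sup>2 = S\<^sup>2 + 4 * m\<^sup>2 * \<rho>\<^sup>2" "0 < P" "0 < P + S" "0 < P - S"
proof -
  have "P\<^sup>2 = ((z - m)\<^sup>2 + \<rho>\<^sup>2) * ((z + m)\<^sup>2 + \<rho>\<^sup>2)"
    by (simp add: P_def)
  also have "\<dots> = S\<^sup>2 + 4 * m\<^sup>2 * \<rho>\<^sup>2"
    unfolding S_def by (simp add: power2_eq_square algebra_simps)
  finally show eq: "P\<^sup>2 = S\<^sup>2 + 4 * m\<^sup>2 * \<rho>\<^sup>2" .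
  show "0 < P" unfolding P_def using assms by (simp add: sum_power2_gt_zero_iff)
  have "0 < 4 * m\<^sup>2 * \<rho>\<^sup>2" using assms(1,2) by simp
  then have "\<bar>S\<bar>\<^sup>2 < P\<^sup>2" using eq by simp
  then have "\<bar>S\<bar> < P" using \<open>0 < P\<close> by (simp add: power2_less_imp_less)
  then show "0 < P + S" "0 < P - S" by auto
qed

text \<open>The right-hand side is \<rho>/2 times the product of the two partial derivatives of
  \<open>omega_S\<close>, so this is the \<open>z\<close>-equation for \<open>k\<close> of a single
  rod. Both sides reduce to z (P - S) / P^2.\<close>

lemma has_derivative_schwarzschild_k:
  assumes "0 < m" "0 < \<rho>"
  defines "r1 \<equiv> \<lambda>z. sqrt ((z - m)\<^sup>2 + \<rho>\<^sup>2)" and "r2 \<equiv> \<lambda>z. sqrt ((z + m)\<^sup>2 + \<rho>\<^sup>2)"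
  shows "((\<lambda>z. schwarzschild_k m z \<rho>) has_real_derivative
    (1 / r1 z - 1 / r2 z) * ((z + m) / r2 z - (z - m) / r1 z) / 2) (at z)"
proof -
  define P where "P z = sqrt (((z - m)\<^sup>2 + \<rho>\<^sup>2) * ((z + m)\<^sup>2 + \<rho>\<^sup>2))" for z
  define S where "S z = z\<^sup>2 + \<rho>\<^sup>2 - m\<^sup>2" for z
  have b: "(P z)\<^sup>2 = (S z)\<^sup>2 + 4 * m\<^sup>2 * \<rho>\<^sup>2" "0 < P z" "0 < P z + S z" for z
    using schwarzschild_root_bounds[OF assms(1,2), of z] by (auto simp: P_def S_def)
  have r: "0 < r1 z" "0 < r2 z" "(r1 z)\<^sup>2 = (z - m)\<^sup>2 + \<rho>\<^sup>2" "(r2 z)\<^sup>2 = (z + m)\<^sup>2 + \<rho>\<^sup>2"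
    using assms(2) by (auto simp: r1_def r2_def sum_power2_gt_zero_iff)
  have P: "P z = r1 z * r2 z" by (simp add: P_def r1_def r2_def real_sqrt_mult)
  have Q: "0 < ((z - m)\<^sup>2 + \<rho>\<^sup>2) * ((z + m)\<^sup>2 + \<rho>\<^sup>2)"
    using assms(2) by (simp add: sum_power2_gt_zero_iff)
  have "(P has_real_derivative
      inverse (P z) / 2 * (2 * (z - m) * ((z + m)\<^sup>2 + \<rho>\<^sup>2) + ((z - m)\<^sup>2 + \<rho>\<^sup>2) * (2 * (z + m)))) (at z)"
    unfolding P_def
    by (rule DERIV_chain2[where f = sqrt and
          g = "\<lambda>z. ((z - m)\<^sup>2 + \<rho>\<^sup>2) * ((z + m)\<^sup>2 + \<rho>\<^sup>2)", OF DERIV_real_sqrt[OF Q]]) (auto intro!: derivative_eq_intros)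
  also have "2 * (z - m) * ((z + m)\<^sup>2 + \<rho>\<^sup>2) + ((z - m)\<^sup>2 + \<rho>\<^sup>2) * (2 * (z + m)) = 4 * z * S z"
    unfolding S_def by (simp add: power2_eq_square algebra_simps)
  finally have "(P has_real_derivative inverse (P z) / 2 * (4 * z * S z)) (at z)" .
  then have dP: "(P has_real_derivative 2 * z * S z / P z) (at z)"
    by (rule DERIV_cong) (simp add: inverse_eq_divide)
  have dS: "(S has_real_derivative 2 * z) (at z)"
    unfolding S_def by (auto intro!: derivative_eq_intros)
  have "((\<lambda>z. (ln (P z + S z) - ln (2 * P z)) / 2) has_real_derivative
      ((2 * z * S z / P z + 2 * z) / (P z + S z) - (2 * z * S z / P z) / P z) / 2) (at z)"
  proof -
    have "0 < 2 * P z" using b(2) by simp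
    note ln1 = DERIV_chain2[where f = ln, OF DERIV_ln_divide[OF b(3)] DERIV_add[OF dP dS]]
      and ln2 = DERIV_chain2[where f = ln, OF DERIV_ln_divide[OF this] DERIV_cmult[OF dP, of 2]]
    have "(1 / (P z + S z) * (A + B) - 1 / (2 * P z) * (2 * A)) / 2 = ((A + B) / (P z + S z) - A / P z) / 2" for A B
      by simp
    with DERIV_cdivide[OF DERIV_diff[OF ln1 ln2], of 2] show ?thesis by (simp only:)
  qed
  moreover have "(\<lambda>z. schwarzschild_k m z \<rho>) = (\<lambda>z. (ln (P z + S z) - ln (2 * P z)) / 2)"
  proof
    fix z
    have "schwarzschild_k m z \<rho> = ln ((P z + S z) / (2 * P z)) / 2"
      by (simp add: schwarzschild_k_def P_def S_def Let_def)
    also have "ln ((P z + S z) / (2 * P z)) = ln (P z + S z) - ln (2 * P z)"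
      using b(2,3)[of z] by (simp add: ln_div)
    finally show "schwarzschild_k m z \<rho> = (ln (P z + S z) - ln (2 * P z)) / 2" .
  qed
  moreover have "((2 * z * S z / P z + 2 * z) / (P z + S z) - (2 * z * S z / P z) / P z) / 2 =
      z * (P z - S z) / (P z)\<^sup>2"
  proof -
    have "2 * z * S z / P z + 2 * z = 2 * z / P z * (P z + S z)"
      using b(2)[of z] by (simp add: field_simps)
    then have "(2 * z * S z / P z + 2 * z) / (P z + S z) = 2 * z / P z"
      using b(3)[of z] by simp
    note eq = this
    show ?thesis unfolding eq
      using b(2)[of z] by (simp add: field_simps power2_eq_square)
  qed
  moreover have "(1 / r1 z - 1 / r2 z) * ((z + m) / r2 z - (z - m) / r1 z) / 2 =
      z * (P z - S z) / (P z)\<^sup>2"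
  proof -
    have "1 / r1 z - 1 / r2 z = (r2 z - r1 z) / P z"
      and "(z + m) / r2 z - (z - m) / r1 z = ((z + m) * r1 z - (z - m) * r2 z) / P z"
      using r by (simp_all add: P diff_frac_eq mult_ac)
    then have "(1 / r1 z - 1 / r2 z) * ((z + m) / r2 z - (z - m) / r1 z) / 2 =
        (r2 z - r1 z) * ((z + m) * r1 z - (z - m) * r2 z) / 2 / (P z)\<^sup>2"
      by (simp add: power2_eq_square)
    also have "(r2 z - r1 z) * ((z + m) * r1 z - (z - m) * r2 z) =
        2 * z * P z - (z - m) * (r2 z)\<^sup>2 - (z + m) * (r1 z)\<^sup>2"
      unfolding P by (simp add: power2_eq_square algebra_simps)
    also have "\<dots> = 2 * (z * (P z - S z))"
      unfolding r S_def by (simp add: power2_eq_square algebra_simps)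
    finally show ?thesis by simp
  qed
  ultimately show ?thesis by simp
qed

text \<open>Above the rod P and S coincide at \<open>\<rho> = 0\<close>, so the argument of the
  logarithm is 1 there.\<close>

lemma schwarzschild_k_axis:
  assumes "0 < m" "m < z"
  shows "(schwarzschild_k m z \<longlongrightarrow> 0) (at_right 0)"
proof -
  have sq: "((z - m)\<^sup>2 + 0\<^sup>2) * ((z + m)\<^sup>2 + 0\<^sup>2) = (z\<^sup>2 - m\<^sup>2)\<^sup>2"
    by (simp add: power2_eq_square algebra_simps)
  have pos: "0 < z\<^sup>2 - m\<^sup>2" using assms by (simp add: power_strict_mono)
  then have P0: "sqrt (((z - m)\<^sup>2 + 0\<^sup>2) * ((z + m)\<^sup>2 + 0\<^sup>2)) = z\<^sup>2 - m\<^sup>2"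
    unfolding sq by simp
  have "isCont (schwarzschild_k m z) 0"
    unfolding schwarzschild_k_def Let_def
    by (intro continuous_intros) (use P0 pos in \<open>auto\<close>)
  then have "(schwarzschild_k m z \<longlongrightarrow> schwarzschild_k m z 0) (at_right 0)"
    by (simp add: isCont_def filterlim_at_split)
  moreover have "schwarzschild_k m z 0 = 0"
    unfolding schwarzschild_k_def Let_def P0 using pos by simp
  ultimately show ?thesis by simp
qed

text \<open>
  Multiplying numerator and denominator by \<open>(R + 2 m)\<^sup>2\<close>, with \<open>R = r\<^sub>1 + r\<^sub>2\<close>, cancels the vanishing factor
  \<open>R - 2 m\<close> and turns the exponential of twice the left-hand side into an expression \<open>X\<close> continuous at \<open>\<rho> = 0\<close>.
\<close>

lemma schwarzschild_horizon:
  assumes "0 < m" "\<bar>z\<bar> < m"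
  shows "((\<lambda>\<rho>. schwarzschild_k m z \<rho> - omega_S m z \<rho> + ln \<rho>) \<longlongrightarrow> ln (4 * m)) (at_right 0)"
proof -
  define r1 where "r1 \<rho> = sqrt ((z - m)\<^sup>2 + \<rho>\<^sup>2)" for \<rho>
  define r2 where "r2 \<rho> = sqrt ((z + m)\<^sup>2 + \<rho>\<^sup>2)" for \<rho>
  define S where "S \<rho> = z\<^sup>2 + \<rho>\<^sup>2 - m\<^sup>2" for \<rho>
  define X where "X \<rho> = (r1 \<rho> + r2 \<rho> + 2 * m) ^ 4 * (r1 \<rho> * r2 \<rho> - S \<rho>) / (32 * m\<^sup>2 * (r1 \<rho> * r2 \<rho>))" for \<rho>
  have r0: "r1 0 = m - z" "r2 0 = z + m" using assms by (auto simp: r1_def r2_def)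
  have X0: "X 0 = (4 * m)\<^sup>2"
  proof -
    \<comment> \<open>Between the poles P = w = - S at \<open>\<rho> = 0\<close>, so (P - S)/P = 2,
      while r1 + r2 + 2m = 4m.\<close>
    define w where "w = (m - z) * (z + m)"
    have "S 0 = - w"
      by (simp add: w_def S_def power2_eq_square algebra_simps)
    moreover have "w \<noteq> 0" using assms by (auto simp: w_def)
    ultimately have "X 0 = (4 * m) ^ 4 * 2 / (32 * m\<^sup>2)"
      unfolding X_def r0 w_def[symmetric] using assms by simp
    also have "\<dots> = (4 * m)\<^sup>2" using assms by (simp add: power2_eq_square power4_eq_xxxx)
    finally show ?thesis .
  qed
  have "isCont (\<lambda>\<rho>. ln (X \<rho>) / 2) 0"
    unfolding X_def r1_def r2_def S_def
    by (intro continuous_intros)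
       (use X0 r0 assms in \<open>auto simp: X_def r1_def r2_def S_def\<close>)
  then have "((\<lambda>\<rho>. ln (X \<rho>) / 2) \<longlongrightarrow> ln (X 0) / 2) (at_right 0)"
    by (simp add: isCont_def filterlim_at_split)
  moreover have "ln (X 0) / 2 = ln (4 * m)" 
    using assms ln_realpow[of "4 * m" 2] unfolding X0 by simp
  moreover have "\<forall>\<^sub>F \<rho> in at_right 0.
      ln (X \<rho>) / 2 = schwarzschild_k m z \<rho> - omega_S m z \<rho> + ln \<rho>"
  proof (rule eventually_at_right_less[THEN eventually_mono])
    fix \<rho> :: real assume \<rho>: "0 < \<rho>"
    define P where "P = r1 \<rho> * r2 \<rho>"
    define R where "R = r1 \<rho> + r2 \<rho>"
    have P': "P = sqrt (((z - m)\<^sup>2 + \<rho>\<^sup>2) * ((z + m)\<^sup>2 + \<rho>\<^sup>2))"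
      by (simp add: P_def r1_def r2_def real_sqrt_mult)
    have b: "P\<^sup>2 = (S \<rho>)\<^sup>2 + 4 * m\<^sup>2 * \<rho>\<^sup>2" "0 < P" "0 < P + S \<rho>" "0 < P - S \<rho>"
      using schwarzschild_root_bounds[OF assms(1) \<rho>, of z] unfolding P' S_def by auto
    have "(R - 2 * m) * (R + 2 * m) = (r1 \<rho>)\<^sup>2 + (r2 \<rho>)\<^sup>2 + 2 * P - 4 * m\<^sup>2"
      by (simp add: R_def P_def power2_eq_square algebra_simps)
    also have "\<dots> = 2 * (P + S \<rho>)"
      by (simp add: r1_def r2_def S_def) (simp add: power2_eq_square algebra_simps)
    finally have RR: "(R - 2 * m) * (R + 2 * m) = 2 * (P + S \<rho>)" .
    have "0 \<le> R" by (simp add: R_def r1_def r2_def)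
    then have R: "0 < R + 2 * m" using assms by simp
    moreover have "0 < (R - 2 * m) * (R + 2 * m)" using b by (simp add: RR)
    ultimately have R': "0 < R - 2 * m" using zero_less_mult_pos2 by blast
    have PS: "(P - S \<rho>) * (P + S \<rho>) = 4 * m\<^sup>2 * \<rho>\<^sup>2"
      using b(1) by (simp add: power2_eq_square algebra_simps)
    have "X \<rho> = (P + S \<rho>) / (2 * P) * ((R + 2 * m) / (R - 2 * m) * \<rho>)\<^sup>2"
    proof -
      have "X \<rho> = (R + 2 * m) ^ 4 * (P - S \<rho>) / (32 * m\<^sup>2 * P)"
        by (simp add: X_def R_def P_def)
      moreover have "(R + 2 * m) ^ 4 * (P - S \<rho>) * (2 * P * (R - 2 * m)\<^sup>2) =
          (P + S \<rho>) * ((R + 2 * m) * \<rho>)\<^sup>2 * (32 * m\<^sup>2 * P)"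
      proof -
        have "(R + 2 * m) ^ 4 * (P - S \<rho>) * (2 * P * (R - 2 * m)\<^sup>2) =
            2 * P * (R + 2 * m)\<^sup>2 * (P - S \<rho>) * ((R - 2 * m) * (R + 2 * m))\<^sup>2"
          by (simp add: power2_eq_square power4_eq_xxxx mult_ac)
        also have "\<dots> = 8 * P * (R + 2 * m)\<^sup>2 * (P + S \<rho>) * ((P - S \<rho>) * (P + S \<rho>))"
          unfolding RR by algebra
        also have "\<dots> = (P + S \<rho>) * ((R + 2 * m) * \<rho>)\<^sup>2 * (32 * m\<^sup>2 * P)"
          unfolding PS by (simp add: power2_eq_square mult_ac)
        finally show ?thesis .
      qed
      ultimately show ?thesis
        using b R' assms by (simp add: power_mult_distrib power_divide frac_eq_eq mult_ac)
    qed
    note X = this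
    have "ln (X \<rho>) = ln ((P + S \<rho>) / (2 * P)) + 2 * (ln ((R + 2 * m) / (R - 2 * m)) + ln \<rho>)"
    proof -
      have "ln (U * (V * \<rho>)\<^sup>2) = ln U + 2 * (ln V + ln \<rho>)" if "0 < U" "0 < V" for U V
        using that \<rho> by (simp add: ln_mult_pos ln_realpow)
      then show ?thesis unfolding X by this (use b R R' in auto)
    qed
    moreover have "ln ((R + 2 * m) / (R - 2 * m)) = - omega_S m z \<rho>"
      using R R' unfolding omega_S_def R_def r1_def r2_def by (simp add: ln_div)
    moreover have "schwarzschild_k m z \<rho> = ln ((P + S \<rho>) / (2 * P)) / 2"
      by (simp add: schwarzschild_k_def P' S_def Let_def)
    ultimately show "ln (X \<rho>) / 2 = schwarzschild_k m z \<rho> - omega_S m z \<rho> + ln \<rho>"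
      by simp
  qed
  ultimately show ?thesis by (auto intro: Lim_transform_eventually)
qed

subsection \<open>The horizon area\<close>

text \<open>Both \<open>g - f\<close> and \<open>g + f\<close> are nondecreasing. Increments are
  thus bounded by an explicit primitive of the derivative bound, without integrating the derivative
  of \<open>f\<close>.\<close>

lemma abs_diff_le_of_derivative_le:
  fixes f g :: "real \<Rightarrow> real"
  assumes "a \<le> b"
    and "\<And>x. a \<le> x \<Longrightarrow> x \<le> b \<Longrightarrow> \<exists>d. (f has_real_derivative d) (at x) \<and> \<bar>d\<bar> \<le> g' x"
    and "\<And>x. a \<le> x \<Longrightarrow> x \<le> b \<Longrightarrow> (g has_real_derivative g' x) (at x)"
  shows "\<bar>f b - f a\<bar> \<le> g b - g a"
proof -
  have "g a - f a \<le> g b - f b"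
  proof (rule DERIV_nonneg_imp_nondecreasing[OF assms(1)])
    fix x assume x: "a \<le> x" "x \<le> b"
    then obtain d where "(f has_real_derivative d) (at x)" "\<bar>d\<bar> \<le> g' x" using assms(2) by blast
    then show "\<exists>y. ((\<lambda>x. g x - f x) has_real_derivative y) (at x) \<and> 0 \<le> y"
      by (intro exI[of _ "g' x - d"] conjI DERIV_diff assms(3) x) auto
  qed
  moreover have "g a + f a \<le> g b + f b"
  proof (rule DERIV_nonneg_imp_nondecreasing[OF assms(1)])
    fix x assume x: "a \<le> x" "x \<le> b"
    then obtain d where "(f has_real_derivative d) (at x)" "\<bar>d\<bar> \<le> g' x" using assms(2) by blast
    then show "\<exists>y. ((\<lambda>x. g x + f x) has_real_derivative y) (at x) \<and> 0 \<le> y"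
      by (intro exI[of _ "g' x + d"] conjI DERIV_add assms(3) x) auto
  qed
  ultimately show ?thesis by linarith
qed

section \<open>The part of \<open>mkn_omega\<close> that is regular near the horizon\<close>

definition images :: "real \<Rightarrow> real \<Rightarrow> real \<Rightarrow> real \<Rightarrow> real" where
  "images L m z \<rho> = image_sum L m z \<rho> + image_sum L m (- z) \<rho>"

lemma images_derivatives:
  assumes "0 < m" "2 * m < L"
  obtains C where "0 \<le> C"
    and "\<And>z \<rho>. \<bar>z\<bar> < L / 2 \<Longrightarrow>
      \<exists>d. ((\<lambda>z. images L m z \<rho>) has_real_derivative d) (at z) \<and> \<bar>d\<bar> \<le> C"
    and "\<And>z \<rho>. \<bar>z\<bar> < L / 2 \<Longrightarrow>
      \<exists>e. (images L m z has_real_derivative e) (at \<rho>) \<and> \<bar>e\<bar> \<le> C * \<bar>\<rho>\<bar>"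
proof -
  \<comment> \<open>With this margin m - L + a = - L/2, so \<open>\<bar>z\<bar> < L / 2\<close>
    admits both \<open>z\<close> and \<open>- z\<close>.\<close>
  define a where "a = L / 2 - m"
  have "0 < a" "a < L - m" using assms by (auto simp: a_def)
  with image_sum_derivatives[of m a L] assms obtain C where C: "0 \<le> C"
    and dz: "\<And>s \<rho>. m - L + a < s \<Longrightarrow>
      \<exists>d. ((\<lambda>s. image_sum L m s \<rho>) has_real_derivative d) (at s) \<and> \<bar>d\<bar> \<le> C"
    and dr: "\<And>s \<rho>. m - L + a < s \<Longrightarrow>
      \<exists>e. (image_sum L m s has_real_derivative e) (at \<rho>) \<and> \<bar>e\<bar> \<le> C * \<bar>\<rho>\<bar>"
    by metis
  show ?thesis
  proof (rule that[of "2 * C"])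
    show "0 \<le> 2 * C" using C by simp
    fix z \<rho> :: real assume z: "\<bar>z\<bar> < L / 2"
    then have z': "m - L + a < z" "m - L + a < - z" by (auto simp: a_def)
    obtain d1 d2 where d: "((\<lambda>s. image_sum L m s \<rho>) has_real_derivative d1) (at z)" "\<bar>d1\<bar> \<le> C"
      "((\<lambda>s. image_sum L m s \<rho>) has_real_derivative d2) (at (- z))" "\<bar>d2\<bar> \<le> C"
      using dz[OF z'(1), of \<rho>] dz[OF z'(2), of \<rho>] by blast
    have "((\<lambda>z. images L m z \<rho>) has_real_derivative d1 + d2 * (- 1)) (at z)"
      unfolding images_def
      by (intro DERIV_add d(1) DERIV_chain2[where g = uminus, OF d(3)]) (auto intro!: derivative_eq_intros)
    with d show "\<exists>d. ((\<lambda>z. images L m z \<rho>) has_real_derivative d) (at z) \<and> \<bar>d\<bar> \<le> 2 * C"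
      by (intro exI[of _ "d1 + d2 * (- 1)"]) auto
    obtain e1 e2 where e: "(image_sum L m z has_real_derivative e1) (at \<rho>)" "\<bar>e1\<bar> \<le> C * \<bar>\<rho>\<bar>"
      "(image_sum L m (- z) has_real_derivative e2) (at \<rho>)" "\<bar>e2\<bar> \<le> C * \<bar>\<rho>\<bar>"
      using dr[OF z'(1), of \<rho>] dr[OF z'(2), of \<rho>] by blast
    have "(images L m z has_real_derivative e1 + e2) (at \<rho>)"
      using DERIV_add[OF e(1,3)] by (simp add: images_def[abs_def])
    with e show "\<exists>e. (images L m z has_real_derivative e) (at \<rho>) \<and> \<bar>e\<bar> \<le> 2 * C * \<bar>\<rho>\<bar>"
      by (intro exI[of _ "e1 + e2"]) auto
  qed
qed

lemma mkn_omega_eq_images: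
  assumes "0 < m" "m < L" "\<bar>z\<bar> < L - m"
  shows "mkn_omega L m z \<rho> = omega_S m z \<rho> + images L m z \<rho>"
  using mkn_omega_eq[OF assms] by (simp add: images_def)

lemma mkn_omega_derivatives:
  fixes L m z \<rho> hz hr :: real
  assumes "0 < m" "2 * m < L" "\<bar>z\<bar> < L / 2" "0 < \<rho>"
    and "((\<lambda>z. images L m z \<rho>) has_real_derivative hz) (at z)"
    and "(images L m z has_real_derivative hr) (at \<rho>)"
  defines "r1 \<equiv> sqrt ((z - m)\<^sup>2 + \<rho>\<^sup>2)" and "r2 \<equiv> sqrt ((z + m)\<^sup>2 + \<rho>\<^sup>2)"
  shows "mkn_omega_z L m z \<rho> = 1 / r1 - 1 / r2 + hz"
    and "mkn_omega_rho L m z \<rho> = ((z + m) / r2 - (z - m) / r1) / \<rho> + hr"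
proof -
  have "((\<lambda>z. omega_S m z \<rho> + images L m z \<rho>) has_real_derivative 1 / r1 - 1 / r2 + hz) (at z)"
    unfolding r1_def r2_def using assms(1-5)
    by (intro DERIV_add has_derivative_omega_S_left) auto
  then have "((\<lambda>z. mkn_omega L m z \<rho>) has_real_derivative 1 / r1 - 1 / r2 + hz) (at z)"
    by (rule has_field_derivative_transform_within_open[of _ _ _ "{- L / 2 <..< L / 2}"])
       (use assms(1-3) in \<open>auto simp: mkn_omega_eq_images\<close>)
  then show "mkn_omega_z L m z \<rho> = 1 / r1 - 1 / r2 + hz"
    unfolding mkn_omega_z_def by (rule DERIV_imp_deriv)
  have "mkn_omega L m z = (\<lambda>\<rho>. omega_S m z \<rho> + images L m z \<rho>)"
    using assms(1-3) by (auto simp: fun_eq_iff mkn_omega_eq_images)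
  then have "(mkn_omega L m z has_real_derivative
      ((z + m) / r2 - (z - m) / r1) / \<rho> + hr) (at \<rho>)"
    unfolding r1_def r2_def using assms(1-6)
    by (simp only:) (intro DERIV_add has_derivative_omega_S_right)
  then show "mkn_omega_rho L m z \<rho> = ((z + m) / r2 - (z - m) / r1) / \<rho> + hr"
    unfolding mkn_omega_rho_def by (simp add: DERIV_imp_deriv)
qed

lemma has_derivative_root:
  fixes c z \<rho> :: real
  assumes "0 < \<rho>"
  shows "((\<lambda>z. sqrt ((z + c)\<^sup>2 + \<rho>\<^sup>2)) has_real_derivative (z + c) / sqrt ((z + c)\<^sup>2 + \<rho>\<^sup>2)) (at z)"
proof -
  have pos: "0 < (z + c)\<^sup>2 + \<rho>\<^sup>2" using assms by (simp add: sum_power2_gt_zero_iff)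
  have "((\<lambda>z. (z + c)\<^sup>2 + \<rho>\<^sup>2) has_real_derivative 2 * (z + c)) (at z)"
    by (auto intro!: derivative_eq_intros)
  note DERIV_chain2[where f = sqrt, OF DERIV_real_sqrt[OF pos] this]
  moreover have "inverse s / 2 * (2 * x) = x / s" for s x :: real
    by (simp add: inverse_eq_divide)
  ultimately show ?thesis by (simp only:)
qed

text \<open>The difference \<open>G\<close> of \<open>k\<close> and \<open>schwarzschild_k\<close>
  is followed along \<open>\<rho>\<close> = const from a point of the outer axis, where its limit is
  0, to the pole and on to \<open>z0\<close>. Up to vanishing errors \<open>G\<close> is unchanged
  on the first stretch and changes like \<open>images\<close> on the second, so
  \<open>G - images\<close> at \<open>z0\<close> tends to minus the value of \<open>images\<close>
  at the pole. The single-rod limit \<open>ln (4 * m)\<close> supplies the rest.\<close>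

lemma horizon_limit:
  assumes m: "0 < m" and L: "2 * m < L" and k: "is_mkn_k L m k" and z0: "\<bar>z0\<bar> < m"
  shows "((\<lambda>\<rho>. \<rho> * exp (k z0 \<rho> - mkn_omega L m z0 \<rho>)) \<longlongrightarrow> 4 * m * exp (- images L m m 0)) (at_right 0)"
proof -
  obtain C where C: "0 \<le> C"
    and dz: "\<And>z \<rho>. \<bar>z\<bar> < L / 2 \<Longrightarrow>
      \<exists>d. ((\<lambda>z. images L m z \<rho>) has_real_derivative d) (at z) \<and> \<bar>d\<bar> \<le> C"
    and dr: "\<And>z \<rho>. \<bar>z\<bar> < L / 2 \<Longrightarrow>
      \<exists>e. (images L m z has_real_derivative e) (at \<rho>) \<and> \<bar>e\<bar> \<le> C * \<bar>\<rho>\<bar>"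
    using images_derivatives[OF m L] by metis
  \<comment> \<open>A point of the outer axis where the normalisation of \<open>k\<close> applies
    and which is also inside the range \<open>\<bar>z\<bar> < L / 2\<close> of the derivative
    bounds.\<close>
  define z1 where "z1 = (m + L / 2) / 2"
  have z1: "m < z1" "z1 < L / 2" using L by (auto simp: z1_def)
  define r1 where "r1 \<rho> z = sqrt ((z - m)\<^sup>2 + \<rho>\<^sup>2)" for \<rho> z
  define r2 where "r2 \<rho> z = sqrt ((z + m)\<^sup>2 + \<rho>\<^sup>2)" for \<rho> z
  define w where "w \<rho> z = (z + m) / r2 \<rho> z - (z - m) / r1 \<rho> z" for \<rho> z
  define G where "G \<rho> z = k z \<rho> - schwarzschild_k m z \<rho>" for \<rho> z
  have dw: "((\<lambda>z. r2 \<rho> z - r1 \<rho> z) has_real_derivative w \<rho> z) (at z)" if "0 < \<rho>" for \<rho> z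
    unfolding r1_def r2_def w_def
    using DERIV_diff[OF has_derivative_root[OF that, of m] has_derivative_root[OF that, of "- m"]]
    by simp
  \<comment> \<open>As \<rho> tends to 0, \<open>w\<close> tends to 0 above the upper pole and to 2
    between the poles. The first bound is therefore used outside the horizon and the second on
    it.\<close>
  have main: "\<exists>gz hz. (G \<rho> has_real_derivative gz) (at z) \<and>
      ((\<lambda>z. images L m z \<rho>) has_real_derivative hz) (at z) \<and>
      \<bar>gz\<bar> \<le> (C * \<rho> + C\<^sup>2 * \<rho>\<^sup>2) / 2 + C / 2 * w \<rho> z \<and>
      \<bar>gz - hz\<bar> \<le> (C * \<rho> + C\<^sup>2 * \<rho>\<^sup>2) / 2 + C / 2 * (2 - w \<rho> z)"
    if z: "\<bar>z\<bar> < L / 2" and \<rho>: "0 < \<rho>" for z \<rho>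
  proof -
    obtain hz hr where h: "((\<lambda>z. images L m z \<rho>) has_real_derivative hz) (at z)" "\<bar>hz\<bar> \<le> C"
      "(images L m z has_real_derivative hr) (at \<rho>)" "\<bar>hr\<bar> \<le> C * \<rho>"
      using dz[OF z, of \<rho>] dr[OF z, of \<rho>] \<rho> by auto
    define u where "u = \<rho> * (1 / r1 \<rho> z - 1 / r2 \<rho> z)"
    define W where "W = w \<rho> z"
    define x where "x = u * hr + \<rho> * hz * hr"
    have \<omega>: "mkn_omega_z L m z \<rho> = 1 / r1 \<rho> z - 1 / r2 \<rho> z + hz"
        "mkn_omega_rho L m z \<rho> = w \<rho> z / \<rho> + hr"
      using mkn_omega_derivatives[OF m L z \<rho> h(1,3)] by (simp_all add: r1_def r2_def w_def)
    have "(G \<rho> has_real_derivative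
        \<rho> / 2 * (mkn_omega_z L m z \<rho> * mkn_omega_rho L m z \<rho>) -
        (1 / r1 \<rho> z - 1 / r2 \<rho> z) * w \<rho> z / 2) (at z)"
      unfolding G_def[abs_def] r1_def r2_def w_def
      using k \<rho> by (intro DERIV_diff has_derivative_schwarzschild_k m) (auto simp: is_mkn_k_def)
    also have "\<rho> / 2 * (mkn_omega_z L m z \<rho> * mkn_omega_rho L m z \<rho>) -
        (1 / r1 \<rho> z - 1 / r2 \<rho> z) * w \<rho> z / 2 = (x + W * hz) / 2"
    proof -
      \<comment> \<open>The singular product of the two single-rod derivatives cancels against
        \<open>schwarzschild_k\<close>; only cross terms and the product of the regular derivatives
        remain.\<close>
      have "\<rho> / 2 * ((q + hz) * (W / \<rho> + hr)) - q * W / 2 =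
          (\<rho> * q * hr + \<rho> * hz * hr + W * hz) / 2" for q
        using \<rho> by (simp add: field_simps)
      then show ?thesis unfolding \<omega> x_def u_def W_def by blast
    qed
    finally have g: "(G \<rho> has_real_derivative (x + W * hz) / 2) (at z)" .
    have frac: "0 \<le> \<rho> / sqrt (s\<^sup>2 + \<rho>\<^sup>2) \<and> \<rho> / sqrt (s\<^sup>2 + \<rho>\<^sup>2) \<le> 1
        \<and> \<bar>s / sqrt (s\<^sup>2 + \<rho>\<^sup>2)\<bar> \<le> 1" for s
    proof -
      have "0 < sqrt (s\<^sup>2 + \<rho>\<^sup>2)" using \<rho> by (simp add: sum_power2_gt_zero_iff)
      moreover have "\<rho> \<le> sqrt (s\<^sup>2 + \<rho>\<^sup>2)" by (rule real_le_rsqrt) simp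
      ultimately show ?thesis using \<rho> root_ge_abs[of s \<rho>] by (simp add: abs_divide)
    qed
    have u: "\<bar>u\<bar> \<le> 1"
      using frac[of "z - m"] frac[of "z + m"] unfolding u_def r1_def r2_def
      by (auto simp: right_diff_distrib abs_le_iff)
    have W: "0 \<le> W" "W \<le> 2"
    proof -
      \<comment> \<open>s / sqrt (s^2 + \<rho>^2) increases in s, which makes \<open>w\<close>
        nonnegative.\<close>
      have mono: "(z - m) / r1 \<rho> z \<le> (z + m) / r2 \<rho> z"
      proof (rule DERIV_nonneg_imp_nondecreasing[where f = "\<lambda>s. s / sqrt (s\<^sup>2 + \<rho>\<^sup>2)" and a = "z - m" and b = "z + m",
            folded r1_def r2_def])
        fix s :: real
        define r where "r = sqrt (s\<^sup>2 + \<rho>\<^sup>2)"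
        have r: "0 < r" "r\<^sup>2 = s\<^sup>2 + \<rho>\<^sup>2" using \<rho> by (auto simp: r_def sum_power2_gt_zero_iff)
        have "((\<lambda>s. s / sqrt (s\<^sup>2 + \<rho>\<^sup>2)) has_real_derivative (r - s * (s / r)) / (r * r)) (at s)"
        proof -
          have d: "((\<lambda>s. sqrt (s\<^sup>2 + \<rho>\<^sup>2)) has_real_derivative s / r) (at s)"
            using has_derivative_root[OF \<rho>, of 0 s] by (simp add: r_def)
          have "sqrt (s\<^sup>2 + \<rho>\<^sup>2) \<noteq> 0" using r(1) unfolding r_def by linarith
          from DERIV_divide[OF DERIV_ident d this] show ?thesis by (simp only: r_def mult_1)
        qed
        moreover have "r - s * (s / r) = \<rho>\<^sup>2 / r" using r by (simp add: field_simps power2_eq_square)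
        ultimately show "\<exists>y. ((\<lambda>s. s / sqrt (s\<^sup>2 + \<rho>\<^sup>2)) has_real_derivative y) (at s) \<and> 0 \<le> y"
          using r by (intro exI[of _ "(r - s * (s / r)) / (r * r)"]) auto
      qed (use m in auto)
      then show "0 \<le> W" by (simp add: W_def w_def)
      show "W \<le> 2" using frac[of "z - m"] frac[of "z + m"]
        unfolding W_def w_def r1_def r2_def by linarith
    qed
    have x: "\<bar>x\<bar> \<le> C * \<rho> + C\<^sup>2 * \<rho>\<^sup>2"
    proof -
      have "\<bar>u * hr\<bar> \<le> 1 * (C * \<rho>)" unfolding abs_mult using u h by (intro mult_mono) auto
      moreover have "\<bar>\<rho> * hz * hr\<bar> \<le> \<rho> * C * (C * \<rho>)"
        unfolding abs_mult using h C \<rho> by (intro mult_mono) auto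
      ultimately show ?thesis unfolding x_def by (simp add: power2_eq_square mult_ac)
    qed
    have half: "\<bar>(p + q) / 2\<bar> \<le> B / 2 + C / 2 * v"
      if "\<bar>p\<bar> \<le> B" "\<bar>q\<bar> \<le> C * v" for p q B v :: real
    proof -
      have "\<bar>p + q\<bar> \<le> B + C * v" using that by linarith
      then show ?thesis by (simp add: add_divide_distrib[symmetric])
    qed
    have "\<bar>W * hz\<bar> \<le> C * W"
      unfolding abs_mult using W h mult_mono[of "\<bar>W\<bar>" W "\<bar>hz\<bar>" C] by (simp add: mult.commute)
    from half[OF x this]
    have b1: "\<bar>(x + W * hz) / 2\<bar> \<le> (C * \<rho> + C\<^sup>2 * \<rho>\<^sup>2) / 2 + C / 2 * W" .
    have "\<bar>(W - 2) * hz\<bar> \<le> C * (2 - W)"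
      unfolding abs_mult using W h mult_mono[of "\<bar>W - 2\<bar>" "2 - W" "\<bar>hz\<bar>" C] by (simp add: mult.commute)
    from half[OF x this]
    have b2: "\<bar>(x + W * hz) / 2 - hz\<bar> \<le> (C * \<rho> + C\<^sup>2 * \<rho>\<^sup>2) / 2 + C / 2 * (2 - W)"
      by (simp add: field_simps)
    show ?thesis using g h(1) b1 b2 unfolding W_def by blast
  qed
  define c where "c \<rho> = (C * \<rho> + C\<^sup>2 * \<rho>\<^sup>2) / 2" for \<rho>
  \<comment> \<open>\<open>g1\<close> and \<open>g2\<close> are primitives of the two bounds in
    \<open>main\<close>, because \<open>w\<close> is the \<open>z\<close>-derivative of r2 -
    r1.\<close>
  define g1 where "g1 \<rho> z = c \<rho> * z + C / 2 * (r2 \<rho> z - r1 \<rho> z)" for \<rho> z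
  define g2 where "g2 \<rho> z = c \<rho> * z + C / 2 * (2 * z - (r2 \<rho> z - r1 \<rho> z))" for \<rho> z
  have bound1: "\<bar>G \<rho> z1 - G \<rho> m\<bar> \<le> g1 \<rho> z1 - g1 \<rho> m" if "0 < \<rho>" for \<rho>
  proof (rule abs_diff_le_of_derivative_le[where g' = "\<lambda>z. c \<rho> + C / 2 * w \<rho> z"])
    fix z assume "m \<le> z" "z \<le> z1"
    then have "\<bar>z\<bar> < L / 2" using m z1 by auto
    from main[OF this that]
    show "\<exists>d. (G \<rho> has_real_derivative d) (at z) \<and> \<bar>d\<bar> \<le> c \<rho> + C / 2 * w \<rho> z"
      unfolding c_def by blast
    show "(g1 \<rho> has_real_derivative c \<rho> + C / 2 * w \<rho> z) (at z)"
      unfolding g1_def[abs_def]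
      by (intro DERIV_add DERIV_diff DERIV_cmult DERIV_cmult_Id dw[OF that])
  qed (use z1 in simp)
  have bound2: "\<bar>(G \<rho> m - images L m m \<rho>) - (G \<rho> z0 - images L m z0 \<rho>)\<bar> \<le> g2 \<rho> m - g2 \<rho> z0"
    if "0 < \<rho>" for \<rho>
  proof (rule abs_diff_le_of_derivative_le[where g' = "\<lambda>z. c \<rho> + C / 2 * (2 - w \<rho> z)"])
    fix z assume "z0 \<le> z" "z \<le> m"
    then have "\<bar>z\<bar> < L / 2" using z0 L by auto
    from main[OF this that] obtain gz hz where
      "(G \<rho> has_real_derivative gz) (at z)" "((\<lambda>z. images L m z \<rho>) has_real_derivative hz) (at z)"
      "\<bar>gz - hz\<bar> \<le> c \<rho> + C / 2 * (2 - w \<rho> z)"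
      unfolding c_def by blast
    then show "\<exists>d. ((\<lambda>z. G \<rho> z - images L m z \<rho>) has_real_derivative d) (at z) \<and>
        \<bar>d\<bar> \<le> c \<rho> + C / 2 * (2 - w \<rho> z)"
      by (intro exI[of _ "gz - hz"] conjI DERIV_diff)
    show "(g2 \<rho> has_real_derivative c \<rho> + C / 2 * (2 - w \<rho> z)) (at z)"
      unfolding g2_def[abs_def]
      by (intro DERIV_add DERIV_diff DERIV_cmult DERIV_cmult_Id dw[OF that])
  qed (use z0 in simp)
  have pos: "\<forall>\<^sub>F \<rho> in at_right (0::real). 0 < \<rho>" by (rule eventually_at_right_less)
  have "isCont (\<lambda>\<rho>. g1 \<rho> z1 - g1 \<rho> m) 0" "isCont (\<lambda>\<rho>. g2 \<rho> m - g2 \<rho> z0) 0"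
    unfolding g1_def g2_def c_def r1_def r2_def by (auto intro!: continuous_intros)
  moreover have "g1 0 z1 - g1 0 m = 0" "g2 0 m - g2 0 z0 = 0"
  proof -
    have r: "r1 0 z = \<bar>z - m\<bar>" "r2 0 z = \<bar>z + m\<bar>" for z by (simp_all add: r1_def r2_def)
    \<comment> \<open>On the axis r2 - r1 is 2m above the upper pole and 2z between the poles. Hence
      both error increments vanish at \<open>\<rho> = 0\<close>, although \<open>w\<close> jumps
      across the pole in the limit.\<close>
    have "r2 0 z1 - r1 0 z1 = 2 * m" "r2 0 m - r1 0 m = 2 * m" "r2 0 z0 - r1 0 z0 = 2 * z0"
      unfolding r using m z0 z1 by auto
    then show "g1 0 z1 - g1 0 m = 0" "g2 0 m - g2 0 z0 = 0"
      unfolding g1_def g2_def by (simp_all add: c_def)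
  qed
  ultimately have lim: "((\<lambda>\<rho>. g1 \<rho> z1 - g1 \<rho> m) \<longlongrightarrow> 0) (at_right 0)"
      "((\<lambda>\<rho>. g2 \<rho> m - g2 \<rho> z0) \<longlongrightarrow> 0) (at_right 0)"
    by (simp_all add: isCont_def filterlim_at_split)
  have "((\<lambda>\<rho>. G \<rho> z1 - G \<rho> m) \<longlongrightarrow> 0) (at_right 0)"
    by (rule Lim_null_comparison[OF _ lim(1)]) (rule eventually_mono[OF pos], simp add: bound1)
  moreover have "((\<lambda>\<rho>. (G \<rho> m - images L m m \<rho>) - (G \<rho> z0 - images L m z0 \<rho>)) \<longlongrightarrow> 0) (at_right 0)"
    by (rule Lim_null_comparison[OF _ lim(2)]) (rule eventually_mono[OF pos], simp add: bound2)
  moreover have "((\<lambda>\<rho>. G \<rho> z1) \<longlongrightarrow> 0 - 0) (at_right 0)"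
    unfolding G_def using k z1 m
    by (intro tendsto_diff schwarzschild_k_axis) (auto simp: is_mkn_k_def)
  moreover have "(images L m m \<longlongrightarrow> images L m m 0) (at_right 0)"
  proof -
    have "isCont (images L m m) 0" using dr[of m 0] m L by (auto intro: DERIV_isCont)
    then show ?thesis by (simp add: isCont_def filterlim_at_split)
  qed
  \<comment> \<open>The expression telescopes to
    \<open>G \<rho> z0 - images L m z0 \<rho>\<close>.\<close>
  ultimately have "((\<lambda>\<rho>. G \<rho> z1 - (G \<rho> z1 - G \<rho> m) - images L m m \<rho> -
      ((G \<rho> m - images L m m \<rho>) - (G \<rho> z0 - images L m z0 \<rho>)))
      \<longlongrightarrow> (0 - 0) - 0 - images L m m 0 - 0) (at_right 0)"
    by (intro tendsto_diff)
  then have "((\<lambda>\<rho>. G \<rho> z0 - images L m z0 \<rho>) \<longlongrightarrow> - images L m m 0) (at_right 0)"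
    by simp
  from tendsto_exp[OF tendsto_add[OF schwarzschild_horizon[OF m z0] this]]
  have "((\<lambda>\<rho>. exp (schwarzschild_k m z0 \<rho> - omega_S m z0 \<rho> + ln \<rho> + (G \<rho> z0 - images L m z0 \<rho>)))
      \<longlongrightarrow> exp (ln (4 * m) + - images L m m 0)) (at_right 0)" .
  moreover have "exp (ln (4 * m) + - images L m m 0) = 4 * m * exp (- images L m m 0)"
    unfolding exp_add using m by simp
  moreover have "\<forall>\<^sub>F \<rho> in at_right 0.
      exp (schwarzschild_k m z0 \<rho> - omega_S m z0 \<rho> + ln \<rho> + (G \<rho> z0 - images L m z0 \<rho>)) =
      \<rho> * exp (k z0 \<rho> - mkn_omega L m z0 \<rho>)"
    using pos
  proof (rule eventually_mono)
    fix \<rho> :: real assume \<rho>: "0 < \<rho>"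
    have "schwarzschild_k m z0 \<rho> - omega_S m z0 \<rho> + ln \<rho> + (G \<rho> z0 - images L m z0 \<rho>) =
        ln \<rho> + (k z0 \<rho> - mkn_omega L m z0 \<rho>)"
      using mkn_omega_eq_images[of m L z0 \<rho>] m L z0 by (simp add: G_def)
    then show "exp (schwarzschild_k m z0 \<rho> - omega_S m z0 \<rho> + ln \<rho> + (G \<rho> z0 - images L m z0 \<rho>)) =
      \<rho> * exp (k z0 \<rho> - mkn_omega L m z0 \<rho>)"
      using \<rho> by (simp only: exp_add exp_ln)
  qed
  ultimately show ?thesis by (auto intro: Lim_transform_eventually)
qed

lemma horizon_area_eq:
  assumes "0 < m" "2 * m < L" "is_mkn_k L m k"
  shows "mkn_horizon_area L m k = 16 * pi * m\<^sup>2 * exp (- images L m m 0)"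
proof -
  define A where "A = 4 * m * exp (- images L m m 0)"
  have "integral {-m..m} (\<lambda>z. Lim (at_right 0) (\<lambda>\<rho>. \<rho> * exp (k z \<rho> - mkn_omega L m z \<rho>))) =
      integral {-m..m} (\<lambda>z. A)"
  \<comment> \<open>The limit is the same constant at every interior point of the horizon; the two
    poles, where it has not been computed, form a null set.\<close>
  proof (rule integral_spike[of "{-m, m}"])
    fix z assume "z \<in> {-m..m} - {-m, m}"
    then have "\<bar>z\<bar> < m" by auto
    from horizon_limit[OF assms this]
    show "A = Lim (at_right 0) (\<lambda>\<rho>. \<rho> * exp (k z \<rho> - mkn_omega L m z \<rho>))"
      unfolding A_def by (intro tendsto_Lim[symmetric]) auto
  qed auto
  also have "\<dots> = 2 * m * A" using assms by simp
  finally show ?thesis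
    unfolding mkn_horizon_area_def A_def by (simp add: power2_eq_square)
qed

subsection \<open>The distance between the poles\<close>

text \<open>A single image is not enough: the terms at \<open>z\<close> increase with
  \<open>z\<close>. For a pair the two quotients multiply to ((N-m)^2 - x^2) / ((N+m)^2 - x^2),
  which decreases in x^2 because N - m < N + m.\<close>

lemma image_term_sum_mono:
  assumes "0 < m" "m \<le> z" "z < L - m"
  shows "image_term L m z 0 n + image_term L m (- z) 0 n \<le> image_term L m m 0 n + image_term L m (- m) 0 n"
proof -
  define N where "N = (real n + 1) * L"
  have N: "L \<le> N" using assms by (simp add: N_def mult_le_cancel_right1)
  have pair: "omega_S m (N + x) 0 + omega_S m (N + - x) 0 = ln (((N - m)\<^sup>2 - x\<^sup>2) / ((N + m)\<^sup>2 - x\<^sup>2))"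
    if "0 \<le> x" "x < N - m" for x
  proof -
    have "omega_S m (N + x) 0 + omega_S m (N + - x) 0 =
        ln ((N + x - m) / (N + x + m)) + ln ((N + - x - m) / (N + - x + m))"
      using that assms(1) by (simp add: omega_S_axis)
    also have "\<dots> = ln ((N + x - m) / (N + x + m) * ((N + - x - m) / (N + - x + m)))"
      using that assms(1) by (intro ln_mult_pos[symmetric]) auto
    also have "(N + x - m) / (N + x + m) * ((N + - x - m) / (N + - x + m)) =
        ((N - m)\<^sup>2 - x\<^sup>2) / ((N + m)\<^sup>2 - x\<^sup>2)"
      by (simp add: power2_eq_square algebra_simps)
    finally show ?thesis .
  qed
  have sq: "m\<^sup>2 \<le> z\<^sup>2" "z\<^sup>2 < (N - m)\<^sup>2" "(N - m)\<^sup>2 \<le> (N + m)\<^sup>2"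
    using assms N by (auto intro!: power_mono power_strict_mono)
  have "((N - m)\<^sup>2 - z\<^sup>2) * ((N + m)\<^sup>2 - m\<^sup>2) \<le> ((N - m)\<^sup>2 - m\<^sup>2) * ((N + m)\<^sup>2 - z\<^sup>2)"
  proof -
    have "0 \<le> (z\<^sup>2 - m\<^sup>2) * ((N + m)\<^sup>2 - (N - m)\<^sup>2)" using sq by (intro mult_nonneg_nonneg) auto
    then show ?thesis by (simp add: algebra_simps)
  qed
  then have "((N - m)\<^sup>2 - z\<^sup>2) / ((N + m)\<^sup>2 - z\<^sup>2) \<le> ((N - m)\<^sup>2 - m\<^sup>2) / ((N + m)\<^sup>2 - m\<^sup>2)"
    using sq by (intro frac_le_eq[THEN iffD2] divide_nonpos_pos) auto
  moreover have "0 < ((N - m)\<^sup>2 - z\<^sup>2) / ((N + m)\<^sup>2 - z\<^sup>2)" using sq by (intro divide_pos_pos) auto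
  ultimately have "ln (((N - m)\<^sup>2 - z\<^sup>2) / ((N + m)\<^sup>2 - z\<^sup>2)) \<le> ln (((N - m)\<^sup>2 - m\<^sup>2) / ((N + m)\<^sup>2 - m\<^sup>2))"
    by (intro ln_mono) auto
  then show ?thesis
    using pair[of z] pair[of m] assms N
    unfolding image_term_def N_def[symmetric] by simp
qed

text \<open>Bounds the length density from below by the single-rod density times the same factor
  exp(- h(m,0)/2) whose square appears in the area.\<close>

lemma mkn_omega_axis_upper:
  assumes "0 < m" "m < z" "z < L - m"
  shows "mkn_omega L m z 0 \<le> ln ((z - m) / (z + m)) + images L m m 0"
proof -
  have s: "summable (image_term L m x 0)" if "m - L < x" for x
    using summable_image_term[of m L x 0] assms that by (auto intro: summable_rabs_cancel)
  have sum2: "images L m x 0 = (\<Sum>n. image_term L m x 0 n + image_term L m (- x) 0 n)"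
    "summable (\<lambda>n. image_term L m x 0 n + image_term L m (- x) 0 n)" if "\<bar>x\<bar> < L - m" for x
    unfolding images_def image_sum_def using that
    by (intro suminf_add summable_add s; simp)+
  have "images L m z 0 \<le> images L m m 0"
    using assms unfolding sum2(1)[of z, OF abs_less_iff[THEN iffD2]]
    by (subst (1 2) sum2(1)) (auto intro!: suminf_le sum2(2) image_term_sum_mono)
  then show ?thesis
    using assms mkn_omega_eq_images[of m L z 0] by (simp add: omega_S_axis)
qed

lemma omega_S_axis_mono:
  assumes "0 < m" "m < s" "s \<le> t"
  shows "omega_S m s 0 \<le> omega_S m t 0"
proof -
  have "(s - m) / (s + m) \<le> (t - m) / (t + m)"
  proof -
    have "0 \<le> 2 * m * (t - s)" using assms by simp
    then show ?thesis using assms by (simp add: divide_simps) (simp add: algebra_simps)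
  qed
  then show ?thesis using assms by (simp add: omega_S_axis)
qed

text \<open>Serves integrability of the length density: the only singularities on the segment are
  logarithmic, one from the central rod and one from the first image, whose pole is at L - m. All
  remaining images are bounded below uniformly in \<open>z\<close>.\<close>

lemma mkn_omega_axis_lower:
  assumes "0 < m" "2 * m < L"
  obtains c where "\<And>z. m < z \<Longrightarrow> z < L - m \<Longrightarrow>
    c + ln ((z - m) / (z + m)) + ln ((L - z - m) / (L - z + m)) \<le> mkn_omega L m z 0"
proof -
  have s: "summable (image_term L m x 0)" if "m - L < x" for x
    using summable_image_term[of m L x 0] assms that by (auto intro: summable_rabs_cancel)
  \<comment> \<open>A summable minorant, independent of \<open>z\<close>, for the terms of
    \<open>image_sum L m (- z) 0\<close> after the first. The index shift gives (n+2)L - z > (n+1)L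
    + m, and the subtracted term compensates the change of renormalising constant through 1/N -
    1/(N+1) \<le> 1/N^2.\<close>
  define q where "q = (\<lambda>n. image_term L m m 0 n - 2 * m / L * (1 / (real n + 1)\<^sup>2))"
  have sq: "summable q"
    unfolding q_def using assms by (intro summable_diff summable_mult summable_inverse_Suc_squares s) auto
  show ?thesis
  proof (rule that[of "2 * m / L + suminf q + image_sum L m m 0"])
    fix z assume z: "m < z" "z < L - m"
    have "image_sum L m m 0 \<le> image_sum L m z 0"
      unfolding image_sum_def
    proof (intro suminf_le s)
      fix n
      have "L \<le> (real n + 1) * L" using assms by (simp add: mult_le_cancel_right1)
      then show "image_term L m m 0 n \<le> image_term L m z 0 n"
        unfolding image_term_def using assms z by (intro add_right_mono omega_S_axis_mono) auto
    qed (use assms z in auto)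
    moreover have "omega_S m (L - z) 0 + 2 * m / L + suminf q \<le> image_sum L m (- z) 0"
    proof -
      have "q n \<le> image_term L m (- z) 0 (Suc n)" for n
      proof -
        define N where "N = real n + 1"
        have N: "1 \<le> N" by (simp add: N_def)
        have "L \<le> N * L" using assms N by (simp add: mult_le_cancel_right1)
        then have "omega_S m (N * L + m) 0 \<le> omega_S m ((N + 1) * L + - z) 0"
          using assms z by (intro omega_S_axis_mono) (auto simp: algebra_simps)
        moreover have "2 * m / (N * L) - 2 * m / L * (1 / N\<^sup>2) \<le> 2 * m / ((N + 1) * L)"
        proof -
          have "1 / N - 1 / (N + 1) = 1 / (N * (N + 1))" using N by (simp add: diff_frac_eq)
          also have "\<dots> \<le> 1 / N\<^sup>2" using N by (intro divide_left_mono) (auto simp: power2_eq_square)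
          finally have "2 * m / L * (1 / N - 1 / N\<^sup>2) \<le> 2 * m / L * (1 / (N + 1))"
            using assms by (intro mult_left_mono) auto
          then show ?thesis by (simp add: right_diff_distrib mult.commute)
        qed
        ultimately show ?thesis
          unfolding q_def image_term_def by (simp add: N_def add_ac)
      qed
      then have "suminf q \<le> (\<Sum>n. image_term L m (- z) 0 (Suc n))"
        by (intro suminf_le sq) (use s[of "- z"] z in \<open>auto simp: summable_Suc_iff\<close>)
      also have "\<dots> = image_sum L m (- z) 0 - image_term L m (- z) 0 0"
        unfolding image_sum_def using s[of "- z"] z by (intro suminf_split_head) auto
      finally show ?thesis by (simp add: image_term_def)
    qed
    moreover have "mkn_omega L m z 0 = omega_S m z 0 + image_sum L m z 0 + image_sum L m (- z) 0"
      using assms z by (intro mkn_omega_eq) auto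
    ultimately show "2 * m / L + suminf q + image_sum L m m 0 + ln ((z - m) / (z + m)) +
        ln ((L - z - m) / (L - z + m)) \<le> mkn_omega L m z 0"
      using assms z by (simp add: omega_S_axis)
  qed
qed

lemma continuous_on_mkn_omega_axis:
  assumes "0 < m" "2 * m < L"
  shows "continuous_on {m<..<L - m} (\<lambda>z. mkn_omega L m z 0)"
proof -
  have ic: "isCont (\<lambda>s. image_sum L m s 0) s" if "m - L < s" for s
  proof -
    define a where "a = min ((s - (m - L)) / 2) ((L - m) / 2)"
    have "a \<le> (s - (m - L)) / 2" "a \<le> (L - m) / 2" unfolding a_def by (rule min.cobounded1, rule min.cobounded2)
    with assms that have a: "a < L - m" "m - L + a < s" by (simp_all add: field_simps)
    have "0 < a" using assms that by (simp add: a_def)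
    from image_sum_derivatives[OF assms(1) \<open>0 < a\<close> a(1)] a(2) show ?thesis
      by (metis DERIV_isCont)
  qed
  have "continuous_on {m<..<L - m} (\<lambda>z. omega_S m z 0 + image_sum L m z 0 + image_sum L m (- z) 0)"
  proof (intro continuous_at_imp_continuous_on ballI continuous_intros)
    fix z assume z: "z \<in> {m<..<L - m}"
    then show "isCont (\<lambda>z. omega_S m z 0) z"
      using assms by (intro DERIV_isCont[OF has_derivative_omega_S_left]) auto
    show "isCont (\<lambda>z. image_sum L m z 0) z" using z assms by (intro ic) auto
    show "isCont (\<lambda>z. image_sum L m (- z) 0) z"
      using z assms
      by (intro isCont_o2[where f = uminus and g = "\<lambda>s. image_sum L m s 0", OF isCont_minus[OF continuous_ident]] ic) auto
  qed
  then show ?thesis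
    by (rule continuous_on_eq) (use assms in \<open>auto simp: mkn_omega_eq\<close>)
qed

section \<open>Integrability of the length density and the lower bound for the distance\<close>

lemma has_integral_inverse_sqrt:
  fixes a b :: real
  assumes "a < b"
  shows "((\<lambda>z. 1 / sqrt (z - a)) has_integral 2 * sqrt (b - a)) {a<..<b}"
    and "((\<lambda>z. 1 / sqrt (b - z)) has_integral 2 * sqrt (b - a)) {a<..<b}"
proof -
  have "((\<lambda>z. 1 / sqrt (z - a)) has_integral 2 * sqrt (b - a) - 2 * sqrt (a - a)) {a..b}"
  proof (rule fundamental_theorem_of_calculus_interior)
    fix z assume "z \<in> {a<..<b}"
    then show "((\<lambda>z. 2 * sqrt (z - a)) has_vector_derivative 1 / sqrt (z - a)) (at z)"
      unfolding has_real_derivative_iff_has_vector_derivative[symmetric]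
      by (auto intro!: derivative_eq_intros simp: field_simps)
  qed (use assms in \<open>auto intro!: continuous_intros\<close>)
  then show "((\<lambda>z. 1 / sqrt (z - a)) has_integral 2 * sqrt (b - a)) {a<..<b}"
    by (simp add: has_integral_Icc_iff_Ioo)
  have "((\<lambda>z. 1 / sqrt (b - z)) has_integral - 2 * sqrt (b - b) - (- 2 * sqrt (b - a))) {a..b}"
  proof (rule fundamental_theorem_of_calculus_interior)
    fix z assume "z \<in> {a<..<b}"
    then show "((\<lambda>z. - 2 * sqrt (b - z)) has_vector_derivative 1 / sqrt (b - z)) (at z)"
      unfolding has_real_derivative_iff_has_vector_derivative[symmetric]
      by (auto intro!: derivative_eq_intros simp: field_simps)
  qed (use assms in \<open>auto intro!: continuous_intros\<close>)
  then show "((\<lambda>z. 1 / sqrt (b - z)) has_integral 2 * sqrt (b - a)) {a<..<b}"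
    by (simp add: has_integral_Icc_iff_Ioo)
qed

lemma exp_minus_half_ln:
  fixes x y :: real
  assumes "0 < x" "0 < y"
  shows "exp (- ln (x / y) / 2) = sqrt y / sqrt x"
proof -
  have "- ln (x / y) / 2 = ln (sqrt y / sqrt x)"
    using assms by (simp add: ln_div ln_sqrt)
  then show ?thesis using assms by simp
qed

text \<open>Subadditivity of the square root separates a product of endpoint singularities into a
  sum with one singularity in each term, which can be integrated explicitly.\<close>

lemma inverse_sqrt_mult_le:
  fixes x y :: real
  assumes "0 < x" "0 < y"
  shows "1 / (sqrt x * sqrt y) \<le> (1 / sqrt x + 1 / sqrt y) / sqrt (x + y)"
proof -
  have "sqrt (x + y) \<le> sqrt x + sqrt y" using assms by (intro sqrt_add_le_add_sqrt) auto
  moreover have "1 / sqrt x + 1 / sqrt y = (sqrt x + sqrt y) / (sqrt x * sqrt y)"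
    using assms by (simp add: add_frac_eq add.commute)
  ultimately show ?thesis using assms by (simp add: field_simps)
qed

text \<open>Since \<open>integral\<close> is 0 for a function that is not integrable, a lower bound
  on the distance requires this. Continuity gives measurability, and inverse square roots at the two
  poles dominate.\<close>

lemma pole_distance_integrable:
  assumes "0 < m" "2 * m < L"
  shows "(\<lambda>z. exp (- mkn_omega L m z 0 / 2)) integrable_on {m<..<L - m}"
proof -
  obtain c where c: "\<And>z. m < z \<Longrightarrow> z < L - m \<Longrightarrow>
    c + ln ((z - m) / (z + m)) + ln ((L - z - m) / (L - z + m)) \<le> mkn_omega L m z 0"
    using mkn_omega_axis_lower[OF assms] by blast
  \<comment> \<open>The factor \<open>L\<close> bounds sqrt (z + m) sqrt (L - z + m), both radicands
    being at most \<open>L\<close>; the denominator comes from (z - m) + (L - m - z) = L -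
    2m.\<close>
  define K where "K = exp (- c / 2) * L / sqrt (L - 2 * m)"
  define g where "g z = K * (1 / sqrt (z - m) + 1 / sqrt (L - m - z))" for z
  show ?thesis
  proof (rule measurable_bounded_by_integrable_imp_integrable[where g = g])
    show "(\<lambda>z. exp (- mkn_omega L m z 0 / 2)) \<in> borel_measurable (lebesgue_on {m<..<L - m})"
      using continuous_on_mkn_omega_axis[OF assms]
      by (intro continuous_imp_measurable_on_sets_lebesgue continuous_intros) auto
    show "g integrable_on {m<..<L - m}"
      unfolding g_def using assms has_integral_inverse_sqrt[of m "L - m"]
      by (intro integrable_on_mult_right integrable_add) auto
    fix z assume "z \<in> {m<..<L - m}"
    then have z: "m < z" "z < L - m" by auto
    have "exp (- mkn_omega L m z 0 / 2) \<le>
        exp (- c / 2 + (- ln ((z - m) / (z + m)) / 2 + - ln ((L - z - m) / (L - z + m)) / 2))"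
      using c[OF z] by simp
    also have "\<dots> = exp (- c / 2) * (sqrt (z + m) / sqrt (z - m) * (sqrt (L - z + m) / sqrt (L - z - m)))"
      unfolding exp_add using z assms by (subst (1 2) exp_minus_half_ln) auto
    also have "\<dots> = exp (- c / 2) * (sqrt (z + m) * sqrt (L - z + m) * (1 / (sqrt (z - m) * sqrt (L - m - z))))"
      by (simp add: algebra_simps)
    also have "\<dots> \<le> exp (- c / 2) * (sqrt L * sqrt L *
        ((1 / sqrt (z - m) + 1 / sqrt (L - m - z)) / sqrt (z - m + (L - m - z))))"
      using z assms by (intro mult_left_mono mult_mono inverse_sqrt_mult_le) auto
    also have "\<dots> = g z" using assms by (simp add: g_def K_def)
    finally show "norm (exp (- mkn_omega L m z 0 / 2)) \<le> g z" by simp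
  qed auto
qed

text \<open>The upper bound on \<omega> leaves sqrt ((z + m)/(z - m)), and z + m \<ge> 2m reduces
  this to a multiple of 1 / sqrt (z - m).\<close>

lemma pole_distance_ge:
  assumes "0 < m" "2 * m < L"
  shows "exp (- images L m m 0 / 2) * sqrt (2 * m) * (2 * sqrt (L - 2 * m)) \<le> mkn_pole_distance L m"
proof -
  define H where "H = images L m m 0"
  have "((\<lambda>z. exp (- H / 2) * sqrt (2 * m) * (1 / sqrt (z - m))) has_integral
      exp (- H / 2) * sqrt (2 * m) * (2 * sqrt (L - m - m))) {m<..<L - m}"
    using assms by (intro has_integral_mult_right has_integral_inverse_sqrt) auto
  moreover have "((\<lambda>z. exp (- mkn_omega L m z 0 / 2)) has_integral mkn_pole_distance L m) {m<..<L - m}"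
  proof -
    from pole_distance_integrable[OF assms] obtain I where
      I: "((\<lambda>z. exp (- mkn_omega L m z 0 / 2)) has_integral I) {m<..<L - m}" by blast
    then have "mkn_pole_distance L m = I"
      unfolding mkn_pole_distance_def by (intro integral_unique) (simp only: has_integral_Icc_iff_Ioo)
    with I show ?thesis by simp
  qed
  ultimately have "exp (- H / 2) * sqrt (2 * m) * (2 * sqrt (L - m - m)) \<le> mkn_pole_distance L m"
  proof (rule has_integral_le)
    fix z assume "z \<in> {m<..<L - m}"
    then have z: "m < z" "z < L - m" by auto
    have "exp (- H / 2) * sqrt (2 * m) * (1 / sqrt (z - m)) \<le> exp (- H / 2) * (sqrt (z + m) / sqrt (z - m))"
      using z assms by (simp add: divide_right_mono)
    also have "\<dots> = exp (- H / 2 + - ln ((z - m) / (z + m)) / 2)"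
      unfolding exp_add using z assms by (subst exp_minus_half_ln) auto
    also have "\<dots> \<le> exp (- mkn_omega L m z 0 / 2)"
      using mkn_omega_axis_upper[OF assms(1) z] by (simp add: H_def)
    finally show "exp (- H / 2) * sqrt (2 * m) * (1 / sqrt (z - m)) \<le> exp (- mkn_omega L m z 0 / 2)" .
  qed
  then show ?thesis by (simp add: H_def)
qed

section \<open>Comparison of the squared distance with the area\<close>

theorem proposition1:
  fixes L m :: real and k :: "real \<Rightarrow> real \<Rightarrow> real"
  assumes "0 < 2 * m" and "2 * m < L"
    and "is_mkn_k L m k"
  shows "(mkn_pole_distance L m)\<^sup>2 / mkn_horizon_area L m k \<ge> 1 / 130 * (L / (2 * m) - 1)"
proof -
  have m: "0 < m" using assms by simp
  define e where "e = exp (- images L m m 0)"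
  have e: "0 < e" "exp (- images L m m 0 / 2) ^ 2 = e"
    by (simp_all add: e_def exp_double[symmetric])
  have A: "mkn_horizon_area L m k = 16 * pi * m\<^sup>2 * e"
    unfolding e_def by (rule horizon_area_eq[OF m assms(2,3)])
  have "e * (2 * m) * (4 * (L - 2 * m)) = (exp (- images L m m 0 / 2) * sqrt (2 * m) * (2 * sqrt (L - 2 * m)))\<^sup>2"
    unfolding power_mult_distrib e(2) using assms by simp
  also have "\<dots> \<le> (mkn_pole_distance L m)\<^sup>2"
    using assms by (intro power_mono pole_distance_ge[OF m]) auto
  finally have D: "e * (2 * m) * (4 * (L - 2 * m)) \<le> (mkn_pole_distance L m)\<^sup>2" .
  \<comment> \<open>The argument yields the constant 1/\<pi>, and \<pi> < 4 < 130.\<close>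
  have "1 / 130 * (L / (2 * m) - 1) \<le> 1 / pi * (L / (2 * m) - 1)"
    using pi_less_4 assms by (intro mult_right_mono divide_left_mono) auto
  \<comment> \<open>The common factor \<open>e\<close> cancels, leaving 8m(L - 2m) / (16 \<pi>
    m^2).\<close>
  also have "\<dots> = e * (2 * m) * (4 * (L - 2 * m)) / (16 * pi * m\<^sup>2 * e)"
    using m e(1) by (simp add: field_simps power2_eq_square)
  also have "\<dots> \<le> (mkn_pole_distance L m)\<^sup>2 / mkn_horizon_area L m k"
    unfolding A using D m e(1) by (intro divide_right_mono) auto
  finally show ?thesis .
qed

end
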